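(* For every integer $n\geq 3$, there exists a Borel graph $\mathbf{G}$ such that $2=D(\mathbf{G})<n\leq D_B(\mathbf{G})<\aleph_0$.
   Context: A Borel graph is a graph $\mathbf{G}=(X,G)$ whose vertex set $X$ is a standard Borel space and whose edge relation $G\subseteq X\times X$ (symmetric and irreflexive) is a Borel subset of the product space. $\text{Aut}(\mathbf{G})$ denotes the group of all graph automorphisms of $\mathbf{G}$ (not necessarily Borel). A distinguishing coloring of $\mathbf{G}$ is a map $c:X\to I$ into a set $I$ such that for every $\varphi\in\text{Aut}(\mathbf{G})\setminus\{\text{id}\}$ there exists $x\in X$ with $c(x)\neq c(\varphi(x))$ (it need not be a proper vertex coloring). The distinguishing number $D(\mathbf{G})$ is the minimum of the cardinals $|I|$ over all sets $I$ for which there is a distinguishing coloring $c:X\to I$. A Borel distinguishing coloring of $\mathbf{G}$ is a distinguishing coloring $c:X\to I$ that is a Borel map into a standard Borel space $I$. The Borel distinguishing number $D_B(\mathbf{G})$ is the minimum of the cardinals $|I|$ over all standard Borel spaces $I$ for which there is a Borel distinguishing coloring $c:X\to I$. *)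

theory Defs
  imports "HOL-Analysis.Analysis"
begin

unbundle cardinal_syntax

section \<open>Standard Borel spaces and Borel graphs\<close>

text \<open>
  A measurable space is represented by a term of type \<open>'a measure\<close>, of which only the carrier and
  the \<open>\<sigma>\<close>-algebra are used; the measure itself plays no role anywhere below.
\<close>

definition Polish_topology :: "'a topology \<Rightarrow> bool" where
  "Polish_topology T \<longleftrightarrow> completely_metrizable_space T \<and> separable_space T"

definition standard_Borel :: "'a measure \<Rightarrow> bool" where
  "standard_Borel M \<longleftrightarrow>
     (\<exists>T. Polish_topology T \<and> topspace T = space M \<and>
          sets M = sigma_sets (topspace T) {U. openin T U})"

definition Borel_graph :: "'a measure \<Rightarrow> ('a \<times> 'a) set \<Rightarrow> bool" where
  "Borel_graph M E \<longleftrightarrow>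
     standard_Borel M \<and> E \<in> sets (M \<Otimes>\<^sub>M M) \<and> sym E \<and> irrefl E"

definition graph_automorphism :: "'a set \<Rightarrow> ('a \<times> 'a) set \<Rightarrow> ('a \<Rightarrow> 'a) \<Rightarrow> bool" where
  "graph_automorphism X E \<phi> \<longleftrightarrow>
     bij_betw \<phi> X X \<and> (\<forall>x\<in>X. \<forall>y\<in>X. (x, y) \<in> E \<longleftrightarrow> (\<phi> x, \<phi> y) \<in> E)"


section \<open>Distinguishing colorings\<close>

text \<open>
  Automorphisms are maps on the whole type whose values outside \<open>X\<close> are irrelevant, so being
  different from the identity means moving some vertex in \<open>X\<close>.
\<close>

definition distinguishing_coloring ::
    "'a set \<Rightarrow> ('a \<times> 'a) set \<Rightarrow> 'c set \<Rightarrow> ('a \<Rightarrow> 'c) \<Rightarrow> bool" where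
  "distinguishing_coloring X E I c \<longleftrightarrow>
     c \<in> X \<rightarrow> I \<and>
     (\<forall>\<phi>. graph_automorphism X E \<phi> \<and> (\<exists>x\<in>X. \<phi> x \<noteq> x) \<longrightarrow> (\<exists>x\<in>X. c x \<noteq> c (\<phi> x)))"

definition Borel_distinguishing_coloring ::
    "'a measure \<Rightarrow> ('a \<times> 'a) set \<Rightarrow> 'c measure \<Rightarrow> ('a \<Rightarrow> 'c) \<Rightarrow> bool" where
  "Borel_distinguishing_coloring M E N c \<longleftrightarrow>
     standard_Borel N \<and> c \<in> M \<rightarrow>\<^sub>M N \<and> distinguishing_coloring (space M) E (space N) c"


section \<open>Distinguishing numbers\<close>

text \<open>The least cardinality of a member of a nonempty family, unique up to \<open>=o\<close>.\<close>

definition min_card :: "'c set set \<Rightarrow> 'c rel" where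
  "min_card \<I> = (SOME r. (\<exists>I\<in>\<I>. r = |I| ) \<and> (\<forall>I\<in>\<I>. r \<le>o |I| ))"

text \<open>
  A minimum over sets of arbitrary types is not expressible in HOL, so the color sets are taken
  from a fixed type that is large enough: the vertex type for arbitrary colorings, because a
  coloring may be replaced by one whose color set has at most as many elements as there are
  vertices; and the reals for Borel colorings, because every standard Borel space is isomorphic
  to one whose points are reals. The lemmas \<open>distinguishing_number_le\<close> and
  \<open>Borel_distinguishing_number_le\<close> below show that color sets of any other type do not
  lower the minimum.
\<close>

definition distinguishing_number :: "'a set \<Rightarrow> ('a \<times> 'a) set \<Rightarrow> 'a rel" where
  "distinguishing_number X E =
     min_card {I :: 'a set. \<exists>c. distinguishing_coloring X E I c}"

definition Borel_distinguishing_number :: "'a measure \<Rightarrow> ('a \<times> 'a) set \<Rightarrow> real rel" where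
  "Borel_distinguishing_number M E =
     min_card {space N | N :: real measure. \<exists>c. Borel_distinguishing_coloring M E N c}"


section \<open>The minima are attained and do not depend on the type of colors\<close>

lemma min_card:
  assumes "\<I> \<noteq> {}"
  shows "(\<exists>I\<in>\<I>. min_card \<I> = |I| ) \<and> (\<forall>I\<in>\<I>. min_card \<I> \<le>o |I| )"
proof -
  have "\<exists>r\<in>card_of ` \<I>. \<forall>r'\<in>card_of ` \<I>. r \<le>o r'"
    using assms by (intro exists_minim_Card_order) (auto simp: card_of_Card_order)
  then have "\<exists>r. (\<exists>I\<in>\<I>. r = |I| ) \<and> (\<forall>I\<in>\<I>. r \<le>o |I| )"
    by auto
  from someI_ex[OF this] show ?thesis
    unfolding min_card_def .
qed

lemma min_card_le: "I \<in> \<I> \<Longrightarrow> min_card \<I> \<le>o |I|"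
  using min_card[of \<I>] by auto

lemma min_card_attained:
  assumes "\<I> \<noteq> {}" obtains I where "I \<in> \<I>" "min_card \<I> = |I|"
  using min_card[OF assms] by auto

lemma distinguishing_coloring_inj_comp:
  assumes c: "distinguishing_coloring X E I c" and g: "inj_on g (c ` X)" "g ` c ` X \<subseteq> J"
  shows "distinguishing_coloring X E J (g \<circ> c)"
  unfolding distinguishing_coloring_def
proof (intro conjI allI impI)
  show "g \<circ> c \<in> X \<rightarrow> J" using g(2) by auto
next
  fix \<phi> assume \<phi>: "graph_automorphism X E \<phi> \<and> (\<exists>x\<in>X. \<phi> x \<noteq> x)"
  then obtain x where x: "x \<in> X" "c x \<noteq> c (\<phi> x)"
    using c unfolding distinguishing_coloring_def by blast
  have "\<phi> x \<in> X"
    using \<phi> x(1) unfolding graph_automorphism_def bij_betw_def by blast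
  with x g(1) have "(g \<circ> c) x \<noteq> (g \<circ> c) (\<phi> x)"
    by (auto dest: inj_onD)
  with x(1) show "\<exists>x\<in>X. (g \<circ> c) x \<noteq> (g \<circ> c) (\<phi> x)" by blast
qed

lemma distinguishing_coloring_id: "distinguishing_coloring X E X (\<lambda>x. x)"
  unfolding distinguishing_coloring_def by (auto; metis)

lemma distinguishing_number_attained:
  obtains I :: "'a set" and c :: "'a \<Rightarrow> 'a"
  where "distinguishing_coloring X E I c" "distinguishing_number X E = |I|"
proof -
  have "{I :: 'a set. \<exists>c. distinguishing_coloring X E I c} \<noteq> {}"
    using distinguishing_coloring_id by blast
  from min_card_attained[OF this] show ?thesis
    using that unfolding distinguishing_number_def by auto
qed

lemma distinguishing_number_le:
  fixes I :: "'c set"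
  assumes c: "distinguishing_coloring X E I c"
  shows "distinguishing_number X E \<le>o |I|"
proof -
  define g where "g = inv_into X c"
  have g: "inj_on g (c ` X)"
    unfolding g_def by (rule inj_on_inv_into) simp
  have "distinguishing_coloring X E (g ` c ` X) (g \<circ> c)"
    using distinguishing_coloring_inj_comp[OF c g] by simp
  then have "g ` c ` X \<in> {I. \<exists>c. distinguishing_coloring X E I c}" by blast
  then have "distinguishing_number X E \<le>o |g ` c ` X|"
    unfolding distinguishing_number_def by (rule min_card_le)
  also have "|g ` c ` X| \<le>o |c ` X|"
    by (rule card_of_image)
  also have "|c ` X| \<le>o |I|"
    using c unfolding distinguishing_coloring_def by (intro card_of_mono1) auto
  finally show ?thesis .
qed

lemma Polish_lepoll_reals:
  assumes "Polish_topology T"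
  shows "topspace T \<lesssim> (UNIV :: real set)"
proof -
  obtain M d where "Metric_space M d" and T: "T = Metric_space.mtopology M d"
    using assms unfolding Polish_topology_def completely_metrizable_space_def by blast
  then interpret Metric_space M d by simp
  have top: "topspace T = M" unfolding T by simp
  obtain C where C: "countable C" "C \<subseteq> M" "mtopology closure_of C = M"
    using assms unfolding Polish_topology_def separable_space_def T by auto
  define h where "h x = {(a, q). a \<in> C \<and> q \<in> (\<rat> :: real set) \<and> d x a < q}" for x
  have "inj_on h M"
  proof (rule inj_onI, rule ccontr)
    fix x y assume xy: "x \<in> M" "y \<in> M" "h x = h y" "x \<noteq> y"
    then have pos: "d x y / 2 > 0" by simp
    have "x \<in> mtopology closure_of C" using C xy by simp
    then obtain a where a: "a \<in> C" "d x a < d x y / 2"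
      unfolding metric_closure_of using pos by fastforce
    obtain q where q: "q \<in> \<rat>" "d x a < q" "q < d x y / 2"
      using a(2) Rats_dense_in_real by blast
    have "(a, q) \<in> h x" using a q by (simp add: h_def)
    with xy(3) have "d y a < q" by (simp add: h_def)
    moreover have "d x y \<le> d x a + d a y" using a(1) C(2) xy by (intro triangle) auto
    ultimately show False using q commute[of a y] by linarith
  qed
  then have "M \<lesssim> Pow (C \<times> (\<rat> :: real set))"
    unfolding lepoll_def h_def by blast
  also have "\<dots> \<lesssim> Pow (UNIV :: nat set)"
  proof -
    have "countable (C \<times> (\<rat> :: real set))" using C(1) countable_rat by blast
    then obtain f :: "'a \<times> real \<Rightarrow> nat" where "inj_on f (C \<times> \<rat>)"
      unfolding countable_def by blast
    then have "inj_on ((`) f) (Pow (C \<times> \<rat>))" by (rule inj_on_image_Pow)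
    then show ?thesis unfolding lepoll_def by blast
  qed
  also have "\<dots> \<lesssim> (UNIV :: real set)"
    using nat_sets_eqpoll_reals by (simp add: eqpoll_imp_lepoll)
  finally show ?thesis unfolding top .
qed

lemma standard_Borel_vimage:
  assumes N: "standard_Borel N" and f: "bij_betw f J (space N)"
  shows "standard_Borel (vimage_algebra J f N)"
proof -
  obtain T where T: "Polish_topology T" "topspace T = space N"
    "sets N = sigma_sets (topspace T) {U. openin T U}"
    using N unfolding standard_Borel_def by blast
  have fJ: "f \<in> J \<rightarrow> space N" using f by (auto simp: bij_betw_def)
  define T' where "T' = pullback_topology J f T"
  have top': "topspace T' = J"
    using fJ by (auto simp: T'_def topspace_pullback_topology T(2))
  have "homeomorphic_map T' T f"
  proof (rule bijective_open_imp_homeomorphic_map)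
    have "continuous_map T' T (id \<circ> f)"
      unfolding T'_def by (rule continuous_map_pullback) simp
    then show "continuous_map T' T f" by simp
    show "open_map T' T f"
      unfolding open_map_def
    proof (intro allI impI)
      fix S assume "openin T' S"
      then obtain U where U: "openin T U" "S = f -` U \<inter> J"
        unfolding T'_def openin_pullback_topology by blast
      have "U \<subseteq> f ` J" using openin_subset[OF U(1)] f T(2) by (auto simp: bij_betw_def)
      then have "f ` S = U" using U(2) by auto
      then show "openin T (f ` S)" using U(1) by simp
    qed
  qed (use f in \<open>auto simp: top' T(2) bij_betw_def\<close>)
  then have "T' homeomorphic_space T"
    by (metis homeomorphic_map_imp_homeomorphic_space)
  then have "Polish_topology T'"
    using T(1) homeomorphic_completely_metrizable_space homeomorphic_separable_space
    unfolding Polish_topology_def by blast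
  moreover have "sets (vimage_algebra J f N) = sigma_sets J {U. openin T' U}"
  proof -
    have "sets (vimage_algebra J f N) = {f -` A \<inter> J | A. A \<in> sets N}"
      using fJ by (rule sets_vimage_algebra2)
    also have "\<dots> = sigma_sets J {f -` A \<inter> J | A. A \<in> {U. openin T U}}"
      unfolding T(3) using fJ T(2) by (intro sigma_sets_vimage_commute) auto
    also have "{f -` A \<inter> J | A. A \<in> {U. openin T U}} = {U. openin T' U}"
      by (auto simp: T'_def openin_pullback_topology)
    finally show ?thesis .
  qed
  ultimately show ?thesis
    unfolding standard_Borel_def using top' by (metis space_vimage_algebra)
qed

lemma Borel_distinguishing_number_le:
  fixes N :: "'c measure"
  assumes c: "Borel_distinguishing_coloring M E N c"
  shows "Borel_distinguishing_number M E \<le>o |space N|"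
proof -
  have N: "standard_Borel N" and cm: "c \<in> M \<rightarrow>\<^sub>M N"
    and cd: "distinguishing_coloring (space M) E (space N) c"
    using c unfolding Borel_distinguishing_coloring_def by auto
  obtain T where "Polish_topology T" "topspace T = space N"
    using N unfolding standard_Borel_def by blast
  with Polish_lepoll_reals[of T] obtain g :: "'c \<Rightarrow> real" where g: "inj_on g (space N)"
    unfolding lepoll_def by auto
  define J where "J = g ` space N"
  define f where "f = inv_into (space N) g"
  define N' where "N' = vimage_algebra J f N"
  have "bij_betw f J (space N)"
    unfolding f_def J_def using g by (simp add: bij_betw_inv_into inj_on_imp_bij_betw)
  then have "standard_Borel N'"
    unfolding N'_def using N by (rule standard_Borel_vimage[rotated])
  moreover have cN: "c ` space M \<subseteq> space N"
    using cm by (auto dest: measurable_space)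
  moreover have "g \<circ> c \<in> M \<rightarrow>\<^sub>M N'"
    unfolding N'_def
  proof (rule measurable_vimage_algebra2)
    show "g \<circ> c \<in> space M \<rightarrow> J" using cN by (auto simp: J_def)
    have "f ((g \<circ> c) x) = c x" if "x \<in> space M" for x
      using that cN g by (auto simp: f_def)
    then show "(\<lambda>x. f ((g \<circ> c) x)) \<in> M \<rightarrow>\<^sub>M N"
      using cm by (simp cong: measurable_cong)
  qed
  moreover have "distinguishing_coloring (space M) E (space N') (g \<circ> c)"
    using cN by (intro distinguishing_coloring_inj_comp[OF cd] inj_on_subset[OF g])
      (auto simp: N'_def J_def)
  ultimately have "Borel_distinguishing_coloring M E N' (g \<circ> c)"
    unfolding Borel_distinguishing_coloring_def by blast
  then have "space N' \<in>
      {space N | N :: real measure. \<exists>c. Borel_distinguishing_coloring M E N c}"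
    by blast
  then have "Borel_distinguishing_number M E \<le>o |space N'|"
    unfolding Borel_distinguishing_number_def by (rule min_card_le)
  also have "|space N'| \<le>o |space N|"
    unfolding N'_def J_def by (simp add: card_of_image)
  finally show ?thesis .
qed

lemma Borel_distinguishing_number_attained:
  assumes M: "Borel_graph M E"
  obtains N :: "real measure" and c
  where "Borel_distinguishing_coloring M E N c" "Borel_distinguishing_number M E = |space N|"
proof -
  have sM: "standard_Borel M" using M by (simp add: Borel_graph_def)
  obtain T where "Polish_topology T" "topspace T = space M"
    using sM unfolding standard_Borel_def by blast
  with Polish_lepoll_reals[of T] obtain g :: "'a \<Rightarrow> real" where g: "inj_on g (space M)"
    unfolding lepoll_def by auto
  define J where "J = g ` space M"
  define f where "f = inv_into (space M) g"
  define N' where "N' = vimage_algebra J f M"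
  have "bij_betw f J (space M)"
    unfolding f_def J_def using g by (simp add: bij_betw_inv_into inj_on_imp_bij_betw)
  then have "standard_Borel N'"
    unfolding N'_def using sM by (rule standard_Borel_vimage[rotated])
  moreover have "g \<in> M \<rightarrow>\<^sub>M N'"
    unfolding N'_def
  proof (rule measurable_vimage_algebra2)
    show "g \<in> space M \<rightarrow> J" by (auto simp: J_def)
    have "f (g x) = x" if "x \<in> space M" for x
      using that g by (auto simp: f_def)
    then show "(\<lambda>x. f (g x)) \<in> M \<rightarrow>\<^sub>M M"
      by (simp cong: measurable_cong)
  qed
  moreover have "distinguishing_coloring (space M) E (space N') (g \<circ> (\<lambda>x. x))"
    by (rule distinguishing_coloring_inj_comp[OF distinguishing_coloring_id]) (use g in \<open>auto simp: N'_def J_def\<close>)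
  then have "distinguishing_coloring (space M) E (space N') g"
    by (simp add: comp_def)
  ultimately have "Borel_distinguishing_coloring M E N' g"
    unfolding Borel_distinguishing_coloring_def by blast
  then have "{space N | N :: real measure. \<exists>c. Borel_distinguishing_coloring M E N c} \<noteq> {}"
    by blast
  from min_card_attained[OF this] obtain I where
    I: "I \<in> {space N | N :: real measure. \<exists>c. Borel_distinguishing_coloring M E N c}"
    "Borel_distinguishing_number M E = |I|"
    unfolding Borel_distinguishing_number_def by blast
  from I(1) obtain N :: "real measure" and c
    where "I = space N" "Borel_distinguishing_coloring M E N c" by blast
  with I(2) that show ?thesis by blast
qed

end

theory Submission
  imports Defs "HOL-Probability.Infinite_Product_Measure" "HOL-Probability.Probability_Mass_Function"
begin

text \<open>
  Let the vertices be the aperiodic two-sided sequences over an alphabet of \<open>8 * n\<^sup>2\<close> letters, and join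
  each sequence to its shift. The components are bi-infinite paths, and besides translating and
  reversing single paths, automorphisms may exchange any two of them. A coloring is therefore
  distinguishing only if the sequence of colors seen along the orbit of a point, its itinerary,
  determines the point (\<open>same_itinerary_not_distinguishing\<close>).

  With the axiom of choice two colors are enough (\<open>distinguishing_2_coloring\<close>): after choosing a base
  point on each path one colors the paths by pairwise nonisomorphic rigid 0-1 sequences, of which there
  are continuum many. One color is not enough, as paths can be translated.

  A Borel coloring cannot make such choices. Under the Bernoulli measure with uniform letters a Borel
  coloring with few colors carries too little information per step to reconstruct the sequence
  (\<open>Borel_coloring_same_itinerary\<close>); this is the entropy bound for generators, but the large
  alphabet leaves enough room for a direct count. Finitely many Borel colors do suffice: the letters at
  0 and 1 reveal the sequence and, by aperiodicity, also the direction of its path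
  (\<open>pair_coloring\<close>).
\<close>

section \<open>Line graphs of free actions of the integers\<close>

definition line_graph :: "'a set \<Rightarrow> (int \<Rightarrow> 'a \<Rightarrow> 'a) \<Rightarrow> ('a \<times> 'a) set" where
  "line_graph X a = {(x, y). x \<in> X \<and> y \<in> X \<and> (y = a 1 x \<or> x = a 1 y)}"

lemma sym_line_graph: "sym (line_graph X a)"
  by (auto simp: line_graph_def sym_def)

locale free_int_action =
  fixes X :: "'a set" and a :: "int \<Rightarrow> 'a \<Rightarrow> 'a"
  assumes closed: "x \<in> X \<Longrightarrow> a j x \<in> X"
    and zero: "x \<in> X \<Longrightarrow> a 0 x = x"
    and add: "x \<in> X \<Longrightarrow> a (i + j) x = a i (a j x)"
    and free: "x \<in> X \<Longrightarrow> a j x = x \<Longrightarrow> j = 0"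
begin

lemma cancel: "x \<in> X \<Longrightarrow> a (- j) (a j x) = x"
  by (metis add zero add.left_inverse)

lemma eq_iff: "x \<in> X \<Longrightarrow> a i x = a j x \<longleftrightarrow> i = j"
  by (metis add cancel closed free add.commute diff_add_cancel diff_conv_add_uminus right_minus_eq)

lemma inj: "x \<in> X \<Longrightarrow> y \<in> X \<Longrightarrow> a j x = a j y \<longleftrightarrow> x = y"
  by (metis cancel)

lemma irrefl_line_graph: "irrefl (line_graph X a)"
  using free[of _ 1] by (fastforce simp: line_graph_def irrefl_def)

lemma line_graph_orbit_iff:
  assumes "x \<in> X"
  shows "(a i x, a j x) \<in> line_graph X a \<longleftrightarrow> j = i + 1 \<or> i = j + 1"
proof -
  have step: "a 1 (a k x) = a (k + 1) x" for k
    using add[OF assms, of 1 k] by (simp add: algebra_simps)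
  show ?thesis
    using assms closed by (auto simp: line_graph_def step eq_iff[OF assms])
qed

lemma line_graph_iff:
  assumes "x \<in> X"
  shows "(x, y) \<in> line_graph X a \<longleftrightarrow> y = a 1 x \<or> y = a (- 1) x"
proof -
  have "a (- 1) (a 1 y) = y" if "y \<in> X" using cancel[OF that, of 1] by simp
  moreover have "a 1 (a (- 1) x) = x" using cancel[OF assms, of "- 1"] by simp
  ultimately show ?thesis
    using assms closed by (auto simp: line_graph_def)
qed

text \<open>
  An orbit is a bi-infinite path and a connected component, so an automorphism carries it to
  another orbit either in the same direction or backwards.
\<close>

lemma automorphism_on_orbit:
  assumes \<phi>: "graph_automorphism X (line_graph X a) \<phi>" and x: "x \<in> X"
  shows "\<exists>s\<in>{1, - 1}. \<forall>j. \<phi> (a j x) = a (s * j) (\<phi> x)"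
proof -
  have in_X: "\<phi> y \<in> X" if "y \<in> X" for y
    using \<phi> that by (auto simp: graph_automorphism_def bij_betw_def)
  have inj_\<phi>: "\<phi> y = \<phi> z \<longleftrightarrow> y = z" if "y \<in> X" "z \<in> X" for y z
    using \<phi> that by (auto simp: graph_automorphism_def bij_betw_def dest: inj_onD)
  have "\<exists>s\<in>{1, - 1}. \<phi> (a (j + 1) x) = a s (\<phi> (a j x))" for j
  proof -
    have "(\<phi> (a j x), \<phi> (a (j + 1) x)) \<in> line_graph X a"
      using \<phi> x closed line_graph_orbit_iff[OF x, of j "j + 1"]
      by (auto simp: graph_automorphism_def)
    then show ?thesis
      using line_graph_iff in_X closed x by auto
  qed
  then obtain s where s: "\<And>j. s j \<in> {1, - 1}"
    and step: "\<And>j. \<phi> (a (j + 1) x) = a (s j) (\<phi> (a j x))"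
    by metis
  \<comment> \<open>Turning back at some vertex would give its two neighbours the same image.\<close>
  have s_Suc: "s (j + 1) = s j" for j
  proof (rule ccontr)
    assume "s (j + 1) \<noteq> s j"
    then have opp: "s (j + 1) = - s j"
      using s[of j] s[of "j + 1"] by auto
    have "\<phi> (a (j + 1 + 1) x) = a (s (j + 1)) (a (s j) (\<phi> (a j x)))"
      using step[of j] step[of "j + 1"] by simp
    also have "\<dots> = \<phi> (a j x)"
      unfolding opp using cancel in_X closed x by blast
    finally show False
      using inj_\<phi> closed x eq_iff[OF x] by auto
  qed
  have s_const: "s j = s 0" for j
  proof (induction j rule: int_induct[where k = 0])
    case (step2 i) then show ?case using s_Suc[of "i - 1"] by simp
  qed (use s_Suc in auto)
  have "\<phi> (a j x) = a (s 0 * j) (\<phi> x)" for j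
  proof (induction j rule: int_induct[where k = 0])
    case base then show ?case using x in_X zero by simp
  next
    case (step1 i)
    have "\<phi> (a (i + 1) x) = a (s 0) (a (s 0 * i) (\<phi> x))"
      using step[of i] s_const[of i] step1 by simp
    then show ?case
      using add[OF in_X[OF x]] by (simp add: algebra_simps)
  next
    case (step2 i)
    have "a (s 0) (\<phi> (a (i - 1) x)) = a (s 0 * i) (\<phi> x)"
      using step[of "i - 1"] s_const[of "i - 1"] step2 by simp
    also have "\<dots> = a (s 0) (a (s 0 * (i - 1)) (\<phi> x))"
      using add[OF in_X[OF x], of "s 0" "s 0 * (i - 1)"] by (simp add: algebra_simps)
    finally show ?case
      using inj in_X closed x by blast
  qed
  then show ?thesis using s by blast
qed

text \<open>
  Every equivariant bijection is an automorphism, because the edges are defined from the action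
  alone.
\<close>

lemma automorphismI:
  assumes \<phi>: "\<And>z. z \<in> X \<Longrightarrow> \<phi> z \<in> X" and \<psi>: "\<And>z. z \<in> X \<Longrightarrow> \<psi> z \<in> X"
    and inv: "\<And>z. z \<in> X \<Longrightarrow> \<psi> (\<phi> z) = z" "\<And>z. z \<in> X \<Longrightarrow> \<phi> (\<psi> z) = z"
    and equivariant: "\<And>z. z \<in> X \<Longrightarrow> \<phi> (a 1 z) = a 1 (\<phi> z)"
  shows "graph_automorphism X (line_graph X a) \<phi>"
proof -
  have bij: "bij_betw \<phi> X X"
    by (rule bij_betw_byWitness[where f' = \<psi>]) (use \<phi> \<psi> inv in auto)
  moreover have "\<phi> u = \<phi> v \<longleftrightarrow> u = v" if "u \<in> X" "v \<in> X" for u v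
    using inv(1) that by metis
  ultimately show ?thesis
    using \<phi> closed by (auto simp: graph_automorphism_def line_graph_def equivariant[symmetric])
qed

text \<open>
  Distinct points with the same sequence of colors along their orbits are exchanged by a
  color-preserving automorphism: it swaps the two orbits, or, when both points lie on one orbit,
  translates that orbit by a period of its coloring. Hence a distinguishing coloring sends distinct
  points to distinct itineraries.
\<close>

lemma same_itinerary_not_distinguishing:
  assumes x: "x \<in> X" and y: "y \<in> X" and "x \<noteq> y"
    and same: "\<And>j. c (a j x) = c (a j y)"
  shows "\<not> distinguishing_coloring X (line_graph X a) I c"
proof -
  define orbit where "orbit u = {a j u | j. True}" for u
  have orbit_closed: "a i z \<in> orbit u \<longleftrightarrow> z \<in> orbit u" if "z \<in> X" "u \<in> X" for z u i
    unfolding orbit_def using add[OF \<open>u \<in> X\<close>] cancel[OF \<open>z \<in> X\<close>] by (auto; metis)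
  have "\<exists>\<phi>. graph_automorphism X (line_graph X a) \<phi> \<and> \<phi> x \<noteq> x \<and> (\<forall>z\<in>X. c (\<phi> z) = c z)"
  proof (cases "y \<in> orbit x")
    case True
    then obtain p where p: "y = a p x" by (auto simp: orbit_def)
    \<comment> \<open>One orbit: translate it by \<open>p\<close>, a period of the coloring.\<close>
    define \<phi> where "\<phi> q z = (if z \<in> orbit x then a q z else z)" for q z
    have inv: "\<phi> (- q) (\<phi> q z) = z" if "z \<in> X" for q z
      using orbit_closed[OF that x, of q] cancel[OF that, of q] by (auto simp: \<phi>_def)
    have "graph_automorphism X (line_graph X a) (\<phi> p)"
    proof (rule automorphismI)
      show "\<phi> p (\<phi> (- p) z) = z" if "z \<in> X" for z
        using inv[OF that, of "- p"] by simp
      show "\<phi> p (a 1 z) = a 1 (\<phi> p z)" if "z \<in> X" for z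
        using orbit_closed[OF that x, of 1] add[OF that, of p 1] add[OF that, of 1 p]
        by (simp add: \<phi>_def add.commute)
    qed (use inv closed in \<open>auto simp: \<phi>_def\<close>)
    moreover have "x \<in> orbit x" unfolding orbit_def using zero[OF x, symmetric] by blast
    moreover have "c (a p (a j x)) = c (a j x)" for j
      using same[of j] add[OF x, of p j] add[OF x, of j p] p by (simp add: add.commute)
    ultimately show ?thesis
      using p \<open>x \<noteq> y\<close> by (intro exI[of _ "\<phi> p"]) (auto simp: \<phi>_def orbit_def)
  next
    case False
    \<comment> \<open>Two orbits: exchange them; this is an involution.\<close>
    define \<phi> where "\<phi> z = (if z \<in> orbit x then a (THE j. z = a j x) y
      else if z \<in> orbit y then a (THE j. z = a j y) x else z)" for z
    have the: "(THE j. a i u = a j u) = i" if "u \<in> X" for i u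
      using eq_iff[OF that] by (intro the_equality) auto
    have \<phi>_x: "\<phi> (a j x) = a j y" for j
      unfolding \<phi>_def orbit_def using the[OF x] by auto
    have "a j y \<notin> orbit x" for j
      using False orbit_closed[OF y x] by blast
    then have \<phi>_y: "\<phi> (a j y) = a j x" for j
      unfolding \<phi>_def using the[OF y] by (auto simp: orbit_def)
    have cases: "(\<exists>j. z = a j x) \<or> (\<exists>j. z = a j y) \<or> z \<notin> orbit x \<and> z \<notin> orbit y" for z
      by (auto simp: orbit_def)
    have \<phi>_other: "\<phi> z = z" if "z \<notin> orbit x" "z \<notin> orbit y" for z
      using that by (auto simp: \<phi>_def)
    have "graph_automorphism X (line_graph X a) \<phi>"
    proof (rule automorphismI)
      show "\<phi> (\<phi> z) = z" for z
        using cases[of z] \<phi>_x \<phi>_y \<phi>_other by metis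
      then show "\<phi> (\<phi> z) = z" for z .
      show "\<phi> z \<in> X" if "z \<in> X" for z
        using cases[of z] \<phi>_x \<phi>_y \<phi>_other closed x y that by metis
      then show "\<phi> z \<in> X" if "z \<in> X" for z
        using that .
      show "\<phi> (a 1 z) = a 1 (\<phi> z)" if z: "z \<in> X" for z
        using cases[of z] \<phi>_x \<phi>_y \<phi>_other orbit_closed[OF z x, of 1] orbit_closed[OF z y, of 1]
          add[OF x, of 1] add[OF y, of 1] by metis
    qed
    moreover have "c (\<phi> z) = c z" for z
      using cases[of z] \<phi>_x \<phi>_y \<phi>_other same by metis
    ultimately show ?thesis
      using \<phi>_x[of 0] zero x y \<open>x \<noteq> y\<close> by auto
  qed
  then show ?thesis
    using x unfolding distinguishing_coloring_def by metis
qed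

text \<open>
  The axiom of choice picks a base point on every orbit and thereby identifies the orbit with the
  integers. Two colors then suffice: the orbits are colored by pairwise different subsets of the
  integers, chosen so that no translation or reflection maps one of them to another or moves one of
  them to itself. There are enough such subsets because there are at most continuum many points.
\<close>

lemma distinguishing_2_coloring:
  fixes g :: "'a \<Rightarrow> nat set"
  assumes g: "inj_on g X"
  shows "\<exists>c. distinguishing_coloring X (line_graph X a) {..<2::nat} c"
proof -
  define base where "base z = (SOME x. x \<in> X \<and> (\<exists>j. z = a j x))" for z
  have base: "base z \<in> X \<and> (\<exists>j. z = a j (base z))" if "z \<in> X" for z
  proof -
    have "\<exists>x. x \<in> X \<and> (\<exists>j. z = a j x)"
      using that zero[OF that] by metis
    then show ?thesis unfolding base_def by (rule someI_ex)
  qed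
  have base_orbit: "base (a i z) = base z" if "z \<in> X" for i z
  proof -
    have "(\<exists>j. a i z = a j x) \<longleftrightarrow> (\<exists>j. z = a j x)" if "x \<in> X" for x
      using add[OF that] cancel[OF \<open>z \<in> X\<close>] by metis
    then show ?thesis unfolding base_def by metis
  qed
  \<comment> \<open>The even numbers give each set the least element 0 and no upper bound, so that no translation
    by a nonzero number and no reflection leads from one set to another; the odd numbers encode
    the point \<open>x\<close>.\<close>
  define A where "A x = {int (2 * i) | i. True} \<union> {int (2 * i + 1) | i. i \<in> g x}" for x
  have A_0: "0 \<in> A x" and A_nonneg: "i \<in> A x \<Longrightarrow> 0 \<le> i"
    and A_even: "int (2 * m) \<in> A x" for x i m
    by (auto simp: A_def)
  have A_inj: "x = y" if "A x = A y" "x \<in> X" "y \<in> X" for x y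
  proof -
    have "i \<in> g u \<longleftrightarrow> int (2 * i + 1) \<in> A u" for i u
    proof -
      have "int (2 * i + 1) \<noteq> int (2 * k)" for k by presburger
      then show ?thesis unfolding A_def by auto
    qed
    then have "g x = g y" using that(1) by blast
    then show ?thesis using g that(2,3) by (auto dest: inj_onD)
  qed
  define c :: "'a \<Rightarrow> nat" where "c z = of_bool (\<exists>j\<in>A (base z). z = a j (base z))" for z
  have c_iff: "c (a j (base z)) = 1 \<longleftrightarrow> j \<in> A (base z)" if "z \<in> X" for z j
  proof -
    have "base (base z) = base z"
      using base[OF that] base_orbit[of "base z"] by metis
    then have "base (a j (base z)) = base z"
      using base[OF that] base_orbit by metis
    then show ?thesis
      using base[OF that] eq_iff[of "base z"] by (auto simp: c_def)
  qed
  have "distinguishing_coloring X (line_graph X a) {..<2} c"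
    unfolding distinguishing_coloring_def
  proof (intro conjI allI impI)
    show "c \<in> X \<rightarrow> {..<2}" by (auto simp: c_def)
  next
    fix \<phi> assume \<phi>: "graph_automorphism X (line_graph X a) \<phi> \<and> (\<exists>x\<in>X. \<phi> x \<noteq> x)"
    show "\<exists>x\<in>X. c x \<noteq> c (\<phi> x)"
    proof (rule ccontr)
      assume "\<not> (\<exists>x\<in>X. c x \<noteq> c (\<phi> x))"
      then have same: "c (\<phi> z) = c z" if "z \<in> X" for z using that by metis
      have "\<phi> z = z" if z: "z \<in> X" for z
      proof -
        define x where "x = base z"
        have x: "x \<in> X" using base z by (simp add: x_def)
        define y where "y = base (\<phi> x)"
        have \<phi>x: "\<phi> x \<in> X" using \<phi> x by (auto simp: graph_automorphism_def bij_betw_def)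
        then obtain b where y: "y \<in> X" and b: "\<phi> x = a b y" using base y_def by blast
        obtain s where s: "s \<in> {1, - 1}" "\<And>j. \<phi> (a j x) = a (s * j) (\<phi> x)"
          using automorphism_on_orbit \<phi> x by metis
        have iff: "j \<in> A x \<longleftrightarrow> s * j + b \<in> A y" for j
        proof -
          have "\<phi> (a j x) = a (s * j + b) y" using s(2) b add[OF y] by simp
          then show ?thesis
            using same[of "a j x"] closed[OF x] c_iff[OF z, of j] c_iff[OF \<phi>x, of "s * j + b"]
            by (simp add: x_def[symmetric] y_def[symmetric])
        qed
        \<comment> \<open>A reversal would map the set without upper bound to one without lower bound.\<close>
        have "s = 1"
        proof (rule ccontr)
          assume "s \<noteq> 1"
          then have "- int (2 * nat (\<bar>b\<bar> + 1)) + b \<in> A y"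
            using s(1) iff[of "int (2 * nat (\<bar>b\<bar> + 1))"] A_even[of "nat (\<bar>b\<bar> + 1)" x]
            by (auto simp del: of_nat_mult)
          then show False using A_nonneg by fastforce
        qed
        \<comment> \<open>Both sets have the least element 0, which leaves no room for a translation.\<close>
        have "0 \<le> b" using iff[of 0] A_0 A_nonneg by auto
        moreover have "- b \<in> A x" using iff[of "- b"] \<open>s = 1\<close> A_0 by simp
        then have "0 \<le> - b" by (rule A_nonneg)
        ultimately have "b = 0" by simp
        then have "A x = A y" using iff \<open>s = 1\<close> by auto
        then have "x = y" using A_inj x y by blast
        then have "\<phi> x = x" using b \<open>b = 0\<close> zero y by simp
        moreover obtain j where "z = a j x" using base z x_def by blast
        ultimately show ?thesis using s(2) \<open>s = 1\<close> by simp
      qed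
      then show False using \<phi> by blast
    qed
  qed
  then show ?thesis by blast
qed

lemma one_color_not_distinguishing:
  assumes "x \<in> X" and "\<And>y. y \<in> X \<Longrightarrow> c y = c x"
  shows "\<not> distinguishing_coloring X (line_graph X a) I c"
proof (rule same_itinerary_not_distinguishing)
  show "x \<noteq> a 1 x" using free[OF assms(1), of 1] by auto
  show "c (a j x) = c (a j (a 1 x))" for j
    using assms(2)[OF closed[OF assms(1)]] assms(2)[OF closed[OF closed[OF assms(1)]]] by simp
qed (use assms closed in auto)

end

section \<open>Aperiodic two-sided sequences over a finite alphabet\<close>

definition translate :: "int \<Rightarrow> (int \<Rightarrow> real) \<Rightarrow> int \<Rightarrow> real" where
  "translate j y = (\<lambda>i. y (i + j))"

definition aperiodic :: "real set \<Rightarrow> (int \<Rightarrow> real) set" where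
  "aperiodic S = {y. range y \<subseteq> S \<and> (\<forall>p. p \<noteq> 0 \<longrightarrow> translate p y \<noteq> y)}"

lemma translate_translate: "translate i (translate j y) = translate (i + j) y"
  by (simp add: translate_def algebra_simps)

lemma translate_0: "translate j y 0 = y j"
  by (simp add: translate_def)

lemma translate_aperiodic_iff: "translate j y \<in> aperiodic S \<longleftrightarrow> y \<in> aperiodic S"
proof -
  have *: "translate i z \<in> aperiodic S" if z: "z \<in> aperiodic S" for i z
  proof -
    have "translate p z = z" if "translate p (translate i z) = translate i z" for p
    proof -
      have "translate (- i) (translate p (translate i z)) = translate (- i) (translate i z)"
        using that by simp
      then show ?thesis by (simp add: translate_translate) (simp add: translate_def)
    qed
    with z show ?thesis by (auto simp: aperiodic_def translate_def)
  qed
  have "translate (- j) (translate j y) = y"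
    by (simp add: translate_def)
  with * show ?thesis by metis
qed

lemma free_int_action_translate: "free_int_action (aperiodic S) translate"
proof
  show "translate j x = x \<Longrightarrow> j = 0" if "x \<in> aperiodic S" for x j
    using that by (auto simp: aperiodic_def)
qed (auto simp: translate_aperiodic_iff translate_translate, simp add: translate_def)

lemma continuous_on_translate: "continuous_on A (translate j)"
  unfolding translate_def
  by (intro continuous_on_coordinatewise_then_product
      continuous_on_subset[OF continuous_on_product_coordinates]) simp

lemma borel_measurable_translate [measurable]: "translate j \<in> borel_measurable borel"
  using continuous_on_translate by (rule borel_measurable_continuous_onI)

lemma borel_measurable_fun_component [measurable]: "(\<lambda>y :: int \<Rightarrow> real. y i) \<in> borel_measurable borel"
  by (rule measurable_product_coordinates)

lemma gdelta_aperiodic: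
  assumes "finite S"
  shows "gdelta_in euclidean (aperiodic S)"
proof -
  have closed: "closed {y :: int \<Rightarrow> real. y i \<in> S}" for i
    using closed_vimage[OF finite_imp_closed[OF assms], of "\<lambda>y. y i"]
    by (simp add: vimage_def)
  have "open {y. translate p y \<noteq> y}" for p
    by (intro open_Collect_neq continuous_on_translate continuous_on_id)
  have "aperiodic S = (\<Inter>i. {y. y i \<in> S}) \<inter> (\<Inter>p\<in>- {0}. {y. translate p y \<noteq> y})"
    by (auto simp: aperiodic_def)
  moreover have "gdelta_in euclidean (\<Inter>i. {y :: int \<Rightarrow> real. y i \<in> S})"
    using closed by (intro closed_imp_gdelta_in) (auto intro: closed_INT metrizable_space_euclidean)
  moreover have "gdelta_in euclidean (\<Inter>p\<in>- {0}. {y. translate p y \<noteq> y})"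
  proof (rule gdelta_in_Inter)
    show "(\<lambda>p. {y. translate p y \<noteq> y}) ` (- {0}) \<noteq> {}"
    proof -
      have "(1 :: int) \<in> - {0}" by simp
      then show ?thesis by blast
    qed
    show "gdelta_in euclidean U" if "U \<in> (\<lambda>p. {y. translate p y \<noteq> y}) ` (- {0})" for U
      using that \<open>\<And>p. open {y. translate p y \<noteq> y}\<close> by (auto intro: open_imp_gdelta_in)
  qed simp
  ultimately show ?thesis
    by (simp add: gdelta_in_Int)
qed

text \<open>
  The subspace topology works, because \<open>G\<^sub>\<delta>\<close> sets in completely metrizable spaces are completely
  metrizable. A general Borel set would need a finer topology.
\<close>

lemma standard_Borel_gdelta:
  fixes X :: "'a::polish_space set"
  assumes "gdelta_in euclidean X"
  shows "standard_Borel (restrict_space borel X)"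
  unfolding standard_Borel_def
proof (intro exI conjI)
  have "completely_metrizable_space (top_of_set X)"
    using completely_metrizable_space_gdelta_in[OF completely_metrizable_space_euclidean assms] .
  moreover have "separable_space (top_of_set X)"
  proof -
    obtain T where "countable T" "T \<subseteq> X" "X \<subseteq> closure T"
      by (rule separable)
    then show ?thesis
      unfolding separable_space_def
      by (intro exI[of _ T]) (auto simp: closure_of_subtopology Int_absorb1)
  qed
  ultimately show "Polish_topology (top_of_set X)"
    by (simp add: Polish_topology_def)
  have trace: "(\<inter>) X ` \<U> = {(\<lambda>x. x) -` A \<inter> X | A. A \<in> \<U>}" for \<U>
    by auto
  have "sets (restrict_space borel X) = sigma_sets X ((\<inter>) X ` {U. open U})"
    unfolding sets_restrict_space sets_borel trace by (rule sigma_sets_vimage_commute) simp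
  also have "(\<inter>) X ` {U. open U} = {U. openin (top_of_set X) U}"
    by (auto simp: openin_open)
  finally show "sets (restrict_space borel X) =
      sigma_sets (topspace (top_of_set X)) {U. openin (top_of_set X) U}"
    by simp
qed (simp add: space_restrict_space)

lemma aperiodic_borel: "finite S \<Longrightarrow> aperiodic S \<in> sets borel"
proof -
  assume "finite S"
  then have [measurable]: "S \<in> sets borel" by (intro borel_closed finite_imp_closed)
  have [measurable]: "Measurable.pred borel (\<lambda>y :: int \<Rightarrow> real. y i = y j)" for i j
    unfolding pred_def by (rule borel_measurable_eq) measurable
  have "aperiodic S = {y\<in>space borel. (\<forall>i. y i \<in> S) \<and> (\<forall>p\<in>- {0}. translate p y \<noteq> y)}"
    by (auto simp: aperiodic_def)
  also have "\<dots> \<in> sets borel"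
    unfolding translate_def fun_eq_iff by measurable
  finally show ?thesis .
qed


section \<open>The Bernoulli measure\<close>

definition letter :: "real set \<Rightarrow> real measure" where
  "letter S = distr (measure_pmf (pmf_of_set S)) borel (\<lambda>x. x)"

definition bernoulli :: "real set \<Rightarrow> (int \<Rightarrow> real) measure" where
  "bernoulli S = Pi\<^sub>M UNIV (\<lambda>_. letter S)"

lemma prob_space_letter: "prob_space (letter S)"
  unfolding letter_def by (intro prob_space.prob_space_distr prob_space_measure_pmf) simp

lemma sets_letter [simp]: "sets (letter S) = sets borel"
  by (simp add: letter_def)

lemma sets_bernoulli [simp, measurable_cong]: "sets (bernoulli S) = sets borel"
proof -
  have "sets (bernoulli S) = sets (Pi\<^sub>M UNIV (\<lambda>_::int. borel :: real measure))"
    unfolding bernoulli_def by (intro sets_PiM_cong) auto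
  then show ?thesis by (simp add: sets_PiM_equal_borel)
qed

lemma space_bernoulli [simp]: "space (bernoulli S) = UNIV"
  using sets_eq_imp_space_eq[OF sets_bernoulli] by simp

lemma prob_space_bernoulli: "prob_space (bernoulli S)"
  unfolding bernoulli_def by (intro prob_space_PiM prob_space_letter)

lemma bernoulli_box:
  assumes "finite J" "\<And>j. j \<in> J \<Longrightarrow> B j \<in> sets borel"
  shows "measure (bernoulli S) {y. \<forall>j\<in>J. y j \<in> B j} = (\<Prod>j\<in>J. measure (letter S) (B j))"
proof -
  interpret product_prob_space "\<lambda>_::int. letter S" UNIV
    by (intro product_prob_spaceI prob_space_letter)
  have "{y. \<forall>j\<in>J. y j \<in> B j} = prod_emb UNIV (\<lambda>_. letter S) J (Pi\<^sub>E J B)"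
    using assms by (auto simp: prod_emb_def space_PiM PiE_iff letter_def)
  then show ?thesis
    unfolding bernoulli_def using assms by (simp add: measure_PiM_emb)
qed

lemma bernoulli_cylinder:
  assumes "finite S" "finite J" "\<And>j. j \<in> J \<Longrightarrow> w j \<in> S"
  shows "measure (bernoulli S) {y. \<forall>j\<in>J. y j = w j} = (1 / real (card S)) ^ card J"
proof -
  have "measure (letter S) {w j} = 1 / card S" if "j \<in> J" for j
    using assms that
    by (subst letter_def, subst measure_distr)
      (auto simp: measure_pmf_single, subst pmf_of_set, auto simp: indicator_def)
  then show ?thesis
    using bernoulli_box[of J "\<lambda>j. {w j}" S] assms(2) by simp
qed

lemma bernoulli_translate:
  assumes "A \<in> sets borel"
  shows "measure (bernoulli S) (translate j -` A) = measure (bernoulli S) A"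
proof -
  have "distr (bernoulli S) (bernoulli S) (translate j) = bernoulli S"
    using distr_PiM_reindex[of UNIV "\<lambda>_. letter S" "\<lambda>i. i + j" UNIV] prob_space_letter
    by (simp add: bernoulli_def translate_def[abs_def] restrict_UNIV)
  then have "measure (bernoulli S) A = measure (distr (bernoulli S) (bernoulli S) (translate j)) A"
    by simp
  also have "\<dots> = measure (bernoulli S) (translate j -` A)"
    using assms by (subst measure_distr) (auto simp: measurable_cong_sets[OF sets_bernoulli sets_bernoulli])
  finally show ?thesis ..
qed

lemma finite_periodic:
  assumes "finite S" "p > 0"
  shows "finite {y. range y \<subseteq> S \<and> translate p y = y}"
proof (rule inj_on_finite)
  show "inj_on (\<lambda>y. restrict y {0..<p}) {y. range y \<subseteq> S \<and> translate p y = y}"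
  proof (rule inj_onI)
    fix y z assume yz: "y \<in> {y. range y \<subseteq> S \<and> translate p y = y}" "z \<in> {y. range y \<subseteq> S \<and> translate p y = y}"
      "restrict y {0..<p} = restrict z {0..<p}"
    have per: "u (i mod p) = u i" if "translate p u = u" for u i
    proof -
      have "u (r + q * p) = u r" for q r
      proof (induction q rule: int_induct[where k = 0])
        case (step1 q)
        have "u (r + q * p + p) = u (r + q * p)" using fun_cong[OF that] by (simp add: translate_def)
        then show ?case using step1 by (simp add: algebra_simps)
      next
        case (step2 q)
        have "u (r + (q - 1) * p + p) = u (r + (q - 1) * p)"
          using fun_cong[OF that] by (simp add: translate_def)
        then show ?case using step2 by (simp add: algebra_simps)
      qed simp
      from this[of "i mod p" "i div p"] show ?thesis by simp
    qed
    show "y = z"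
    proof
      fix i
      have "y (i mod p) = z (i mod p)"
        using fun_cong[OF yz(3), of "i mod p"] \<open>p > 0\<close> by simp
      then show "y i = z i" using per[of y i] per[of z i] yz(1,2) by simp
    qed
  qed
  show "(\<lambda>y. restrict y {0..<p}) ` {y. range y \<subseteq> S \<and> translate p y = y} \<subseteq> {0..<p} \<rightarrow>\<^sub>E S"
    by auto
  show "finite ({0..<p} \<rightarrow>\<^sub>E S)" using assms by (intro finite_PiE) auto
qed

text \<open>
  Over a finite alphabet there are only countably many periodic sequences, and points have measure
  zero.
\<close>

lemma measure_bernoulli_aperiodic:
  assumes S: "finite S" "card S \<ge> 2"
  shows "measure (bernoulli S) (aperiodic S) = 1"
proof -
  interpret prob_space "bernoulli S" by (rule prob_space_bernoulli)
  have null: "{y} \<in> null_sets (bernoulli S)" if y: "range y \<subseteq> S" for y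
  proof -
    have "measure (bernoulli S) {y} \<le> (1 / 2) ^ n" for n
    proof -
      have "measure (bernoulli S) {y} \<le> measure (bernoulli S) {z. \<forall>j\<in>{0..<int n}. z j = y j}"
        by (intro finite_measure_mono) auto
      also have "\<dots> = (1 / card S) ^ n"
        using bernoulli_cylinder[of S "{0..<int n}" y] S y by (auto simp: image_subset_iff)
      also have "\<dots> \<le> (1 / 2) ^ n"
        using S by (intro power_mono) (auto simp: field_simps)
      finally show ?thesis .
    qed
    moreover have "(\<lambda>n. (1 / 2 :: real) ^ n) \<longlonglongrightarrow> 0"
      by (intro LIMSEQ_power_zero) simp
    ultimately have "measure (bernoulli S) {y} \<le> 0"
      by (intro LIMSEQ_le_const[of _ 0 "measure (bernoulli S) {y}"]) auto
    then show ?thesis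
      by (auto intro!: null_setsI simp: emeasure_eq_measure measure_le_0_iff)
  qed
  define Q where "Q = (\<Union>p\<in>{0<..}. {y. range y \<subseteq> S \<and> translate p y = y})"
  have "countable Q"
    unfolding Q_def using finite_periodic[OF S(1)] by (intro countable_UN) (auto intro: countable_finite)
  have "(\<Union>y\<in>Q. {y}) \<in> null_sets (bernoulli S)"
    using \<open>countable Q\<close> null by (intro null_sets_UN') (auto simp: Q_def)
  then have "AE y in bernoulli S. y \<notin> Q"
    by (intro AE_I') (auto intro: AE_not_in)
  moreover have "AE y in bernoulli S. y i \<in> S" for i
  proof -
    have [measurable]: "S \<in> sets borel" using S by (intro borel_closed finite_imp_closed)
    have "S \<noteq> {}" using S by auto
    then have "measure (letter S) S = 1"
      using S by (subst letter_def, subst measure_distr) (auto simp: measure_pmf_of_set)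
    then have "prob {y. y i \<in> S} = 1"
      using bernoulli_box[of "{i}" "\<lambda>_. S" S] by simp
    then show ?thesis
      by (subst (asm) prob_eq_1) auto
  qed
  then have "AE y in bernoulli S. \<forall>i. y i \<in> S"
    by (subst AE_all_countable) auto
  ultimately have "AE y in bernoulli S. y \<in> aperiodic S"
  proof eventually_elim
    case (elim y)
    have "p = 0" if "translate p y = y" for p
    proof (rule ccontr)
      assume "p \<noteq> 0"
      moreover have "translate (- p) y = y"
        using that translate_translate[of "- p" p y] by (simp add: translate_def)
      ultimately show False
        using that elim by (cases "p > 0") (auto simp: Q_def)
    qed
    then show ?case using elim by (auto simp: aperiodic_def)
  qed
  then show ?thesis
    using aperiodic_borel[OF S(1)] by (subst prob_eq_1) auto
qed

section \<open>Borel colorings with few colors repeat an itinerary\<close>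

text \<open>
  Inner regularity of finite Borel measures on Polish spaces, for countably many sets at once: the
  losses are made to form a geometric series.
\<close>

lemma compact_subsets_sequence:
  fixes M :: "'a::polish_space measure" and A :: "nat \<Rightarrow> 'a set"
  assumes M: "finite_measure M" "sets M = sets borel"
    and A: "\<And>n. A n \<in> sets borel" and "e > 0"
  shows "\<exists>C. (\<forall>n. compact (C n) \<and> C n \<subseteq> A n) \<and> measure M (\<Union>n. A n - C n) \<le> e"
proof -
  interpret finite_measure M by fact
  have finite: "emeasure M (space M) \<noteq> \<infinity>" using emeasure_finite by simp
  have "\<exists>K. compact K \<and> K \<subseteq> A n \<and> measure M (A n - K) \<le> e * (1 / 2) ^ Suc n" for n
  proof -
    have "\<exists>K\<in>{K. K \<subseteq> A n \<and> compact K}. measure M (A n) - e * (1 / 2) ^ Suc n < measure M K"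
    proof (rule ccontr)
      assume "\<not> ?thesis"
      then have "emeasure M (A n) \<le> ennreal (measure M (A n) - e * (1 / 2) ^ Suc n)"
        unfolding inner_regular[OF M(2) finite A[of n]]
        by (intro SUP_least) (auto simp: emeasure_eq_measure not_less intro!: ennreal_leI)
      moreover have "measure M (A n) - e * (1 / 2) ^ Suc n < measure M (A n)"
        using \<open>e > 0\<close> by simp
      moreover have "{} \<in> {K. K \<subseteq> A n \<and> compact K}" by simp
      with \<open>\<not> ?thesis\<close> have "\<not> measure M (A n) - e * (1 / 2) ^ Suc n < measure M {}"
        by blast
      then have "0 \<le> measure M (A n) - e * (1 / 2) ^ Suc n"
        by simp
      ultimately show False
        by (simp add: emeasure_eq_measure)
    qed
    then obtain K where K: "K \<subseteq> A n" "compact K"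
      "measure M (A n) - e * (1 / 2) ^ Suc n < measure M K" by blast
    have "measure M (A n - K) = measure M (A n) - measure M K"
      using K(1,2) A by (intro finite_measure_Diff) (auto simp: M(2) borel_compact)
    with K show ?thesis by (intro exI[of _ K]) linarith
  qed
  then obtain C where C: "\<And>n. compact (C n)" "\<And>n. C n \<subseteq> A n"
    "\<And>n. measure M (A n - C n) \<le> e * (1 / 2) ^ Suc n" by metis
  have sums: "(\<lambda>n. e * (1 / 2) ^ Suc n) sums e"
    using sums_mult[OF power_half_series, of e] by simp
  have summable: "summable (\<lambda>n. measure M (A n - C n))"
  proof (rule summable_comparison_test')
    show "summable (\<lambda>n. e * (1 / 2) ^ Suc n)" using sums by (rule sums_summable)
    show "norm (measure M (A n - C n)) \<le> e * (1 / 2) ^ Suc n" if "0 \<le> n" for n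
      using C(3)[of n] by simp
  qed
  have "measure M (\<Union>n. A n - C n) \<le> (\<Sum>n. measure M (A n - C n))"
    using A C(1) by (intro finite_measure_subadditive_countably summable)
      (auto simp: M(2) borel_compact)
  also have "\<dots> \<le> e"
    using suminf_le[OF C(3) summable sums_summable[OF sums]] sums_unique[OF sums] by simp
  finally show ?thesis using C(1,2) by blast
qed

lemma compact_subsets:
  fixes M :: "'a::polish_space measure" and A :: "'i \<Rightarrow> 'a set"
  assumes M: "finite_measure M" "sets M = sets borel"
    and J: "countable J" and A: "\<And>k. k \<in> J \<Longrightarrow> A k \<in> sets borel" and "e > 0"
  shows "\<exists>C. (\<forall>k\<in>J. compact (C k) \<and> C k \<subseteq> A k) \<and> measure M (\<Union>k\<in>J. A k - C k) \<le> e"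
proof -
  interpret finite_measure M by fact
  define A' where "A' n = (if n \<in> to_nat_on J ` J then A (from_nat_into J n) else {})" for n
  have A'_borel: "A' n \<in> sets borel" for n
    using A J by (auto simp: A'_def)
  have "\<exists>C. (\<forall>n. compact (C n) \<and> C n \<subseteq> A' n) \<and> measure M (\<Union>n. A' n - C n) \<le> e"
    using A'_borel \<open>e > 0\<close> by (intro compact_subsets_sequence M)
  then obtain C where C: "\<forall>n. compact (C n) \<and> C n \<subseteq> A' n"
    and le: "measure M (\<Union>n. A' n - C n) \<le> e"
    by (elim exE conjE) (rule that)
  have A'_eq: "A' (to_nat_on J k) = A k" if "k \<in> J" for k
    using that J by (simp add: A'_def)
  have "measure M (\<Union>k\<in>J. A k - C (to_nat_on J k)) \<le> measure M (\<Union>n. A' n - C n)"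
  proof (rule finite_measure_mono)
    show "(\<Union>k\<in>J. A k - C (to_nat_on J k)) \<subseteq> (\<Union>n. A' n - C n)"
    proof (rule UN_least)
      fix k assume "k \<in> J"
      then have "A k - C (to_nat_on J k) = A' (to_nat_on J k) - C (to_nat_on J k)"
        using A'_eq by simp
      then show "A k - C (to_nat_on J k) \<subseteq> (\<Union>n. A' n - C n)"
        by blast
    qed
    show "(\<Union>n. A' n - C n) \<in> sets M"
    proof -
      have "A' n - C n \<in> sets borel" for n
        using A'_borel borel_compact[of "C n"] C by blast
      then show ?thesis by (auto simp: M(2))
    qed
  qed
  with le have "measure M (\<Union>k\<in>J. A k - C (to_nat_on J k)) \<le> e"
    by simp
  moreover have "\<forall>k\<in>J. compact (C (to_nat_on J k)) \<and> C (to_nat_on J k) \<subseteq> A k"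
    using C A'_eq by metis
  ultimately show ?thesis
    by (intro exI[of _ "\<lambda>k. C (to_nat_on J k)"] conjI)
qed

text \<open>
  If the itinerary of a sequence determines the sequence, then it does so in a continuous way on a
  compact set of almost full measure, on which every \<open>c \<circ> translate j\<close> is continuous (as in
  Lusin's theorem). By compactness, finitely many colors around the origin then determine the
  letter at the origin, with one window size \<open>m\<close> for the whole set. This replaces the measurability
  of the inverse of an injective Borel map.
\<close>

lemma finitely_many_colors_determine_letter:
  fixes c :: "(int \<Rightarrow> real) \<Rightarrow> 'c"
  assumes S: "finite S" "card S \<ge> 2" and I: "finite I"
    and c: "\<And>x. x \<in> aperiodic S \<Longrightarrow> c x \<in> I" "\<And>i. {x \<in> aperiodic S. c x = i} \<in> sets borel"
    and inj: "\<And>x y. x \<in> aperiodic S \<Longrightarrow> y \<in> aperiodic S \<Longrightarrow>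
      (\<And>j. c (translate j x) = c (translate j y)) \<Longrightarrow> x = y"
    and "e > 0"
  shows "\<exists>K m. K \<in> sets borel \<and> measure (bernoulli S) (- K) \<le> e \<and>
    (\<forall>x\<in>K. \<forall>y\<in>K. (\<forall>j. \<bar>j\<bar> \<le> int m \<longrightarrow> c (translate j x) = c (translate j y)) \<longrightarrow> x 0 = y 0)"
proof -
  interpret prob_space "bernoulli S" by (rule prob_space_bernoulli)
  let ?X = "aperiodic S"
  have X [measurable]: "?X \<in> sets borel" using aperiodic_borel S(1) .
  define A where "A = (\<lambda>(j, i). {x \<in> ?X. c (translate j x) = i})"
  have A_borel: "A k \<in> sets borel" for k
  proof -
    obtain j i where k: "k = (j, i)" by fastforce
    have "A k = translate j -` {x \<in> ?X. c x = i} \<inter> space borel"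
      by (auto simp: A_def k translate_aperiodic_iff)
    also have "\<dots> \<in> sets borel"
      by (rule measurable_sets[OF borel_measurable_translate c(2)])
    finally show ?thesis .
  qed
  have J: "countable ((UNIV :: int set) \<times> I)"
    using I by (intro countable_SIGMA) (auto intro: countable_finite)
  have "\<exists>C. (\<forall>k\<in>UNIV \<times> I. compact (C k) \<and> C k \<subseteq> A k) \<and>
      measure (bernoulli S) (\<Union>k\<in>UNIV \<times> I. A k - C k) \<le> e"
    using A_borel \<open>e > 0\<close> by (intro compact_subsets J finite_measure_axioms sets_bernoulli)
  then obtain C where C_A: "\<forall>k\<in>UNIV \<times> I. compact (C k) \<and> C k \<subseteq> A k"
    and le: "measure (bernoulli S) (\<Union>k\<in>UNIV \<times> I. A k - C k) \<le> e"
    by (elim exE conjE) (rule that)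
  have C: "compact (C (j, i))" "C (j, i) \<subseteq> A (j, i)" if "i \<in> I" for i j
    using bspec[OF C_A, of "(j, i)"] that by simp_all
  \<comment> \<open>On \<open>K\<close> the \<open>j\<close>-th color of \<open>x\<close> is the \<open>i\<close> with \<open>x \<in> C (j, i)\<close>, and these sets are closed.\<close>
  define K where "K = (\<Inter>j. \<Union>i\<in>I. C (j, i))"
  have C_borel: "C (j, i) \<in> sets borel" if "i \<in> I" for i j
    using C(1)[OF that] by (rule borel_compact)
  have K_borel: "K \<in> sets borel"
    unfolding K_def using C_borel I by (intro sets.countable_INT'' sets.finite_UN) auto
  have K_A: "\<exists>i\<in>I. x \<in> C (j, i)" if "x \<in> K" for x j
    using that unfolding K_def by blast
  have K_C: "x \<in> C (j, c (translate j x))" if "x \<in> K" for x j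
    using K_A[OF that, of j] C(2) by (auto simp: A_def)
  have K_X: "x \<in> ?X" if "x \<in> K" for x
    using K_A[OF that, of 0] C(2) by (auto simp: A_def)
  have loss_borel: "(\<Union>k\<in>UNIV \<times> I. A k - C k) \<in> sets borel"
    using A_borel C_borel by (intro sets.countable_UN' J) auto
  have "- K \<subseteq> (- ?X) \<union> (\<Union>k\<in>UNIV \<times> I. A k - C k)"
    using c(1) translate_aperiodic_iff by (fastforce simp: K_def A_def)
  then have "measure (bernoulli S) (- K) \<le>
      measure (bernoulli S) ((- ?X) \<union> (\<Union>k\<in>UNIV \<times> I. A k - C k))"
    using loss_borel X by (intro finite_measure_mono) auto
  also have "\<dots> \<le> measure (bernoulli S) (- ?X) + measure (bernoulli S) (\<Union>k\<in>UNIV \<times> I. A k - C k)"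
    using loss_borel X by (intro measure_Un_le) auto
  also have "measure (bernoulli S) (- ?X) = 0"
    using prob_compl[of ?X] measure_bernoulli_aperiodic[OF S] by (simp add: Compl_eq_Diff_UNIV)
  finally have K_measure: "measure (bernoulli S) (- K) \<le> e" using le by simp
  have "\<exists>m::nat. \<forall>x\<in>K. \<forall>y\<in>K. (\<forall>j. \<bar>j\<bar> \<le> int m \<longrightarrow> c (translate j x) = c (translate j y)) \<longrightarrow> x 0 = y 0"
  proof (rule ccontr)
    assume contra: "\<not> ?thesis"
    \<comment> \<open>The pairs that violate the claim for \<open>m\<close> lie in \<open>F m\<close>. These sets are compact and
      decreasing, and a common point would be a pair of different sequences with the same itinerary.\<close>
    define F where "F m = {p :: (int \<Rightarrow> real) \<times> (int \<Rightarrow> real). \<exists>(r, s)\<in>{p \<in> S \<times> S. fst p \<noteq> snd p}.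
        fst p 0 = r \<and> snd p 0 = s} \<inter>
      (\<Inter>j\<in>{j. \<bar>j\<bar> \<le> int m}. \<Union>i\<in>I. C (j, i) \<times> C (j, i))" for m :: nat
    have F_compact: "compact (F m)" for m
    proof -
      have "closed {p :: (int \<Rightarrow> real) \<times> (int \<Rightarrow> real). \<exists>(r, s)\<in>{p \<in> S \<times> S. fst p \<noteq> snd p}.
        fst p 0 = r \<and> snd p 0 = s}" (is "closed ?D")
      proof -
        have comp: "continuous_on UNIV (\<lambda>y :: int \<Rightarrow> real. y 0)" by simp
        have "closed {p :: (int \<Rightarrow> real) \<times> (int \<Rightarrow> real). fst p 0 = r \<and> snd p 0 = s}" for r s
          by (intro closed_Collect_conj closed_Collect_eq continuous_on_const
              continuous_on_compose2[OF comp] continuous_on_fst continuous_on_snd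
              continuous_on_id) auto
        moreover have "?D = (\<Union>(r, s)\<in>{p \<in> S \<times> S. fst p \<noteq> snd p}. {p. fst p 0 = r \<and> snd p 0 = s})"
          by auto
        moreover have "finite {p \<in> S \<times> S. fst p \<noteq> snd p}" using S(1) by simp
        ultimately show ?thesis by (auto intro!: closed_UN)
      qed
      moreover have compact: "compact (\<Union>i\<in>I. C (j, i) \<times> C (j, i))" for j
        using C(1) I by (intro compact_UN compact_Times) auto
      have "closed (\<Inter>j\<in>{j. \<bar>j\<bar> \<le> int m}. \<Union>i\<in>I. C (j, i) \<times> C (j, i))"
        by (intro closed_INT ballI compact_imp_closed compact)
      ultimately have "compact ((\<Union>i\<in>I. C (0, i) \<times> C (0, i)) \<inter> (?D \<inter>
          (\<Inter>j\<in>{j. \<bar>j\<bar> \<le> int m}. \<Union>i\<in>I. C (j, i) \<times> C (j, i))))"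
        by (intro compact_Int_closed closed_Int compact)
      moreover have "F m = (\<Union>i\<in>I. C (0, i) \<times> C (0, i)) \<inter> (?D \<inter>
          (\<Inter>j\<in>{j. \<bar>j\<bar> \<le> int m}. \<Union>i\<in>I. C (j, i) \<times> C (j, i)))"
      proof -
        have "(0 :: int) \<in> {j. \<bar>j\<bar> \<le> int m}" by simp
        then show ?thesis unfolding F_def by blast
      qed
      ultimately show ?thesis by simp
    qed
    have F_nonempty: "F m \<noteq> {}" for m
    proof -
      obtain x y where xy: "x \<in> K" "y \<in> K" "x 0 \<noteq> y 0"
        "\<And>j. \<bar>j\<bar> \<le> int m \<Longrightarrow> c (translate j x) = c (translate j y)"
        using contra by metis
      have "x 0 \<in> S" "y 0 \<in> S" using K_X xy(1,2) by (auto simp: aperiodic_def)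
      moreover have "c (translate j x) \<in> I" for j
        using c(1) K_X xy(1) translate_aperiodic_iff by blast
      ultimately have "(x, y) \<in> F m"
        using xy K_C[OF xy(1)] K_C[OF xy(2)] by (force simp: F_def)
      then show ?thesis by blast
    qed
    have F_antimono: "F n \<subseteq> F m" if "m \<le> n" for m n
    proof -
      have "{j. \<bar>j\<bar> \<le> int m} \<subseteq> {j. \<bar>j\<bar> \<le> int n}" using that by auto
      then show ?thesis unfolding F_def by blast
    qed
    have "F 0 \<inter> (\<Inter>m. F m) \<noteq> {}"
    proof (rule compact_imp_fip[OF F_compact])
      fix F' assume "finite F'" "F' \<subseteq> range F"
      then obtain N where N: "finite N" "F' = F ` N" by (meson finite_subset_image)
      have "F (Max (insert 0 N)) \<subseteq> F n" if "n \<in> insert 0 N" for n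
        using that N(1) by (intro F_antimono Max_ge) auto
      then have "F (Max (insert 0 N)) \<subseteq> F 0 \<inter> \<Inter> F'" using N(2) by auto
      then show "F 0 \<inter> \<Inter> F' \<noteq> {}" using F_nonempty by blast
    qed (use F_compact in \<open>auto intro: compact_imp_closed\<close>)
    then obtain x y where xy: "\<And>m. (x, y) \<in> F m" by auto
    have "x \<in> ?X \<and> y \<in> ?X \<and> c (translate j x) = c (translate j y)" for j
    proof -
      have "\<exists>i\<in>I. (x, y) \<in> C (j, i) \<times> C (j, i)"
        using xy[of "nat \<bar>j\<bar>"] by (auto simp: F_def)
      then obtain i where "i \<in> I" "x \<in> A (j, i)" "y \<in> A (j, i)"
        using C(2) by blast
      then show ?thesis by (simp add: A_def)
    qed
    then have "x = y" using inj by blast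
    then show False using xy[of 0] by (auto simp: F_def)
  qed
  then show ?thesis
    using K_borel K_measure by blast
qed

lemma card_image_le_of_factor:
  assumes "finite Z" "code ` G \<subseteq> Z"
    and "\<And>x y. x \<in> G \<Longrightarrow> y \<in> G \<Longrightarrow> code x = code y \<Longrightarrow> w x = w y"
  shows "card (w ` G) \<le> card Z"
proof -
  define h where "h z = w (SOME x. x \<in> G \<and> code x = z)" for z
  have "h (code x) = w x" if "x \<in> G" for x
  proof -
    have "(SOME y. y \<in> G \<and> code y = code x) \<in> G \<and> code (SOME y. y \<in> G \<and> code y = code x) = code x"
      by (rule someI[of _ x]) (use that in simp)
    then show ?thesis unfolding h_def using assms(3) that by metis
  qed
  then have "w ` G \<subseteq> h ` Z" using assms(2) by force
  then have "card (w ` G) \<le> card (h ` Z)" using assms(1) by (intro card_mono) auto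
  also have "\<dots> \<le> card Z" using assms(1) by (rule card_image_le)
  finally show ?thesis .
qed

text \<open>
  A code lists the colors in the window \<open>V\<close>, the set \<open>B\<close> of at most \<open>l\<close> places of \<open>W\<close> where the colors
  fail to determine the letter, and the letters at these places.
\<close>

lemma card_erasure_codes:
  fixes W :: "int set"
  assumes S: "finite S" "S \<noteq> {}" and W: "finite W" and I: "finite I" "finite V"
  shows "finite ((V \<rightarrow>\<^sub>E I) \<times> (SIGMA B:{B. B \<subseteq> W \<and> card B \<le> l}. B \<rightarrow>\<^sub>E S))"
    and "card ((V \<rightarrow>\<^sub>E I) \<times> (SIGMA B:{B. B \<subseteq> W \<and> card B \<le> l}. B \<rightarrow>\<^sub>E S)) \<le>
      card I ^ card V * (2 ^ card W * card S ^ l)"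
proof -
  let ?P = "{B. B \<subseteq> W \<and> card B \<le> l}"
  have P: "finite ?P" "?P \<subseteq> Pow W" using W by auto
  have fin: "finite B" if "B \<in> ?P" for B using that W finite_subset by auto
  then have PiE: "finite (B \<rightarrow>\<^sub>E S)" if "B \<in> ?P" for B using that S by (intro finite_PiE) auto
  show "finite ((V \<rightarrow>\<^sub>E I) \<times> (SIGMA B:?P. B \<rightarrow>\<^sub>E S))"
  proof (rule finite_cartesian_product)
    show "finite (V \<rightarrow>\<^sub>E I)" using I by (intro finite_PiE) auto
    show "finite (SIGMA B:?P. B \<rightarrow>\<^sub>E S)" using P(1) PiE by (rule finite_SigmaI)
  qed
  have "card (SIGMA B:?P. B \<rightarrow>\<^sub>E S) = (\<Sum>B\<in>?P. card (B \<rightarrow>\<^sub>E S))"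
    using P(1) PiE by (intro card_SigmaI ballI)
  also have "\<dots> \<le> (\<Sum>B\<in>?P. card S ^ l)"
  proof (rule sum_mono)
    fix B assume B: "B \<in> ?P"
    have "card S \<ge> 1" using S by (simp add: Suc_le_eq card_gt_0_iff)
    then show "card (B \<rightarrow>\<^sub>E S) \<le> card S ^ l"
      using B fin[OF B] by (auto simp: card_PiE intro: power_increasing)
  qed
  also have "\<dots> = card ?P * card S ^ l" by simp
  also have "card ?P \<le> 2 ^ card W"
    using card_mono[OF _ P(2)] W by (simp add: card_Pow)
  finally have "card (SIGMA B:?P. B \<rightarrow>\<^sub>E S) \<le> 2 ^ card W * card S ^ l" by simp
  then show "card ((V \<rightarrow>\<^sub>E I) \<times> (SIGMA B:?P. B \<rightarrow>\<^sub>E S)) \<le> card I ^ card V * (2 ^ card W * card S ^ l)"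
    using I by (simp add: card_cartesian_product card_PiE)
qed

text \<open>
  By invariance of the measure the expected number of bad places among \<open>2 * l\<close> is at most \<open>l / 2\<close>, so
  that Markov's inequality leaves at least half of the space with fewer than \<open>l\<close> bad places.
\<close>

lemma bernoulli_frequency:
  assumes K: "K \<in> sets borel" "measure (bernoulli S) (- K) \<le> 1 / 4" and "l > 0"
  shows "{x. card {j \<in> {0..<int (2 * l)}. translate j x \<notin> K} < l} \<in> sets borel"
    and "measure (bernoulli S) {x. card {j \<in> {0..<int (2 * l)}. translate j x \<notin> K} < l} \<ge> 1 / 2"
proof -
  interpret prob_space "bernoulli S" by (rule prob_space_bernoulli)
  let ?W = "{0..<int (2 * l)}"
  define u where "u x = (\<Sum>j\<in>?W. indicator (translate j -` (- K)) x :: real)" for x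
  have K': "translate j -` (- K) \<in> sets borel" for j
    using measurable_sets[OF borel_measurable_translate borel_comp[OF K(1)], of j] by simp
  have u_eq: "u x = real (card {j \<in> ?W. translate j x \<notin> K})" for x
    unfolding u_def by (simp add: indicator_def sum.If_cases Int_def)
  have u_borel: "u \<in> borel_measurable borel"
    unfolding u_def using K' by (intro borel_measurable_sum borel_measurable_indicator)
  have set_eq: "{x. card {j \<in> ?W. translate j x \<notin> K} < l} = {x \<in> space borel. u x < real l}"
    by (simp add: u_eq)
  show few_borel: "{x. card {j \<in> ?W. translate j x \<notin> K} < l} \<in> sets borel"
    unfolding set_eq using u_borel by measurable
  have integrable_ind: "integrable (bernoulli S) (indicator (translate j -` (- K)) :: _ \<Rightarrow> real)" for j
    using K'[of j] by (intro integrable_real_indicator) (auto simp: emeasure_eq_measure)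
  have "(\<integral>x. u x \<partial>bernoulli S) = (\<Sum>j\<in>?W. measure (bernoulli S) (translate j -` (- K)))"
    unfolding u_def using integrable_ind by (subst Bochner_Integration.integral_sum) auto
  also have "\<dots> = (\<Sum>j\<in>?W. measure (bernoulli S) (- K))"
    using K(1) by (intro sum.cong refl bernoulli_translate) auto
  also have "\<dots> \<le> l / 2"
    using mult_left_mono[OF K(2), of "real (2 * l)"] by simp
  finally have int: "(\<integral>x. u x \<partial>bernoulli S) \<le> l / 2" .
  have "measure (bernoulli S) {x \<in> space (bernoulli S). real l \<le> u x} \<le> (\<integral>x. u x \<partial>bernoulli S) / l"
  proof (rule integral_Markov_inequality_measure[where A = "space (bernoulli S)"])
    show "integrable (bernoulli S) u"
      unfolding u_def using integrable_ind by auto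
  qed (use \<open>l > 0\<close> in \<open>auto simp: u_eq\<close>)
  also have "\<dots> \<le> 1 / 2"
    using int \<open>l > 0\<close> by (simp add: field_simps)
  finally have "measure (bernoulli S) {x. real l \<le> u x} \<le> 1 / 2" by simp
  moreover have "{x. real l \<le> u x} = UNIV - {x. card {j \<in> ?W. translate j x \<notin> K} < l}"
    by (auto simp: u_eq)
  ultimately show "measure (bernoulli S) {x. card {j \<in> ?W. translate j x \<notin> K} < l} \<ge> 1 / 2"
    using prob_compl[of "{x. card {j \<in> ?W. translate j x \<notin> K} < l}"] few_borel by simp
qed

text \<open>
  An elementary form of the fact that a generator of a Bernoulli shift cannot have less entropy than
  the shift. Suppose that itineraries determine sequences, and let \<open>k\<close> and \<open>N\<close> be the numbers of colors
  and letters. For at least half of the sequences, the word of length \<open>2 * l\<close> at the origin is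
  determined by the colors in a window of length \<open>2 * l + 2 * m\<close> together with a correction at fewer
  than \<open>l\<close> places. There are at most \<open>k ^ (2 * l + 2 * m) * 4 ^ l * N ^ l\<close> such descriptions, and
  each word has measure \<open>1 / N ^ (2 * l)\<close>. Hence \<open>N ^ l\<close> is at most
  \<open>2 * k ^ (2 * m) * (4 * k\<^sup>2) ^ l\<close>, which fails for large \<open>l\<close> if \<open>8 * k\<^sup>2 \<le> N\<close>.
\<close>

lemma Borel_coloring_same_itinerary:
  fixes c :: "(int \<Rightarrow> real) \<Rightarrow> 'c"
  assumes S: "finite S" "8 * (card I)\<^sup>2 \<le> card S" and I: "finite I" "card I > 0"
    and c: "\<And>x. x \<in> aperiodic S \<Longrightarrow> c x \<in> I" "\<And>i. {x \<in> aperiodic S. c x = i} \<in> sets borel"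
  shows "\<exists>x\<in>aperiodic S. \<exists>y\<in>aperiodic S. x \<noteq> y \<and> (\<forall>j. c (translate j x) = c (translate j y))"
proof (rule ccontr)
  interpret prob_space "bernoulli S" by (rule prob_space_bernoulli)
  let ?X = "aperiodic S"
  define k where "k = card I"
  have k: "k > 0" "8 * k\<^sup>2 \<le> card S" using S I by (auto simp: k_def)
  have "k\<^sup>2 \<ge> 1" using k(1) by (simp add: Suc_le_eq)
  then have S2: "card S \<ge> 2" using k(2) by linarith
  then have "S \<noteq> {}" by auto
  assume "\<not> ?thesis"
  then have inj: "x = y" if "x \<in> ?X" "y \<in> ?X" "\<And>j. c (translate j x) = c (translate j y)" for x y
    using that by blast
  have "\<exists>K m. K \<in> sets borel \<and> measure (bernoulli S) (- K) \<le> 1 / 4 \<and>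
      (\<forall>x\<in>K. \<forall>y\<in>K. (\<forall>j. \<bar>j\<bar> \<le> int m \<longrightarrow> c (translate j x) = c (translate j y)) \<longrightarrow> x 0 = y 0)"
    by (rule finitely_many_colors_determine_letter[OF S(1) S2 I(1) c inj]) simp_all
  then obtain K m where K: "K \<in> sets borel" "measure (bernoulli S) (- K) \<le> 1 / 4"
    and determined: "\<forall>x\<in>K. \<forall>y\<in>K.
      (\<forall>j. \<bar>j\<bar> \<le> int m \<longrightarrow> c (translate j x) = c (translate j y)) \<longrightarrow> x 0 = y 0"
    by (elim exE conjE) (rule that)
  have bound: "2 ^ l \<le> 2 * k ^ (2 * m)" if "l > 0" for l :: nat
  proof -
    let ?W = "{0..<int (2 * l)}" and ?V = "{- int m..<int (2 * l) + int m}"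
    define bad where "bad x = {j \<in> ?W. translate j x \<notin> K}" for x
    define G where "G = {x. card (bad x) < l} \<inter> ?X"
    define word where "word x = restrict x ?W" for x :: "int \<Rightarrow> real"
    define code where "code x = (restrict (\<lambda>j. c (translate j x)) ?V, bad x, restrict x (bad x))" for x
    let ?Z = "(?V \<rightarrow>\<^sub>E I) \<times> (SIGMA B:{B. B \<subseteq> ?W \<and> card B \<le> l}. B \<rightarrow>\<^sub>E S)"
    note codes = card_erasure_codes[of S ?W I ?V l, OF S(1) \<open>S \<noteq> {}\<close>
        finite_atLeastLessThan_int I(1) finite_atLeastLessThan_int]
    have code_Z: "code ` G \<subseteq> ?Z"
    proof (rule image_subsetI)
      fix x assume x: "x \<in> G"
      have "x j \<in> S" for j using x by (auto simp: G_def aperiodic_def)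
      moreover have "c (translate j x) \<in> I" for j
        using c(1) x translate_aperiodic_iff by (auto simp: G_def)
      ultimately show "code x \<in> ?Z"
        using x by (auto simp: code_def G_def bad_def)
    qed
    have code_word: "word x = word y" if "code x = code y" for x y
    proof -
      have bad: "bad x = bad y"
        and window: "restrict (\<lambda>j. c (translate j x)) ?V = restrict (\<lambda>j. c (translate j y)) ?V"
        and corrections: "restrict x (bad x) = restrict y (bad y)"
        using that unfolding code_def prod.inject by blast+
      have "x j = y j" if j: "j \<in> ?W" for j
      proof (cases "j \<in> bad x")
        case True
        then show ?thesis using fun_cong[OF corrections, of j] bad by simp
      next
        case False
        have "translate j x \<in> K" using False j by (simp add: bad_def)
        moreover have "translate j y \<in> K" using False j unfolding bad by (simp add: bad_def)
        moreover have "c (translate i (translate j x)) = c (translate i (translate j y))"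
          if "\<bar>i\<bar> \<le> int m" for i
        proof -
          have "i + j \<in> ?V" using that j by auto
          then show ?thesis
            using fun_cong[OF window, of "i + j"] by (simp add: translate_translate)
        qed
        ultimately have "translate j x 0 = translate j y 0"
          using determined by blast
        then show ?thesis by (simp add: translate_0)
      qed
      then show ?thesis by (auto simp: word_def)
    qed
    have words: "card (word ` G) \<le> card ?Z"
      using card_image_le_of_factor[OF codes(1) code_Z, of word] code_word by blast
    have "card ?V = 2 * l + 2 * m" and card_W: "card ?W = 2 * l" by simp_all
    then have card_Z: "card ?Z \<le> k ^ (2 * l + 2 * m) * (2 ^ (2 * l) * card S ^ l)"
      using codes(2) unfolding k_def by metis
    have word_S: "word ` G \<subseteq> ?W \<rightarrow>\<^sub>E S"
      by (auto simp: word_def G_def aperiodic_def)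
    then have fin: "finite (word ` G)"
      by (rule finite_subset) (use S(1) in \<open>auto intro: finite_PiE\<close>)
    define cyl where "cyl w = {x. \<forall>j\<in>?W. x j = w j}" for w :: "int \<Rightarrow> real"
    have cyl_borel: "cyl w \<in> sets borel" for w
    proof -
      have "cyl w = {x \<in> space borel. \<forall>j\<in>?W. x j = w j}" by (simp add: cyl_def)
      also have "\<dots> \<in> sets borel" by measurable
      finally show ?thesis .
    qed
    have "1 / 2 \<le> measure (bernoulli S) {x. card (bad x) < l}"
      using bernoulli_frequency(2)[OF K \<open>l > 0\<close>] by (simp add: bad_def)
    also have "\<dots> = measure (bernoulli S) G"
    proof -
      have "AE x in bernoulli S. x \<in> ?X"
        using measure_bernoulli_aperiodic[OF S(1) S2] aperiodic_borel[OF S(1)]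
        by (subst (asm) prob_eq_1) auto
      then show ?thesis
        using bernoulli_frequency(1)[OF K \<open>l > 0\<close>] aperiodic_borel[OF S(1)]
        by (intro finite_measure_eq_AE) (auto simp: G_def bad_def)
    qed
    also have "\<dots> \<le> measure (bernoulli S) (\<Union>w\<in>word ` G. cyl w)"
    proof (rule finite_measure_mono)
      show "G \<subseteq> (\<Union>w\<in>word ` G. cyl w)" by (auto simp: word_def cyl_def)
      show "(\<Union>w\<in>word ` G. cyl w) \<in> sets (bernoulli S)"
        using fin cyl_borel by (intro sets.finite_UN) auto
    qed
    also have "\<dots> \<le> (\<Sum>w\<in>word ` G. measure (bernoulli S) (cyl w))"
      using fin cyl_borel by (intro finite_measure_subadditive_finite) auto
    also have "\<dots> = (\<Sum>w\<in>word ` G. (1 / real (card S)) ^ (2 * l))"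
    proof (rule sum.cong[OF refl])
      fix w assume "w \<in> word ` G"
      then have letters: "w j \<in> S" if "j \<in> ?W" for j using word_S that by blast
      then show "measure (bernoulli S) (cyl w) = (1 / real (card S)) ^ (2 * l)"
        using bernoulli_cylinder[of S ?W w, OF S(1) finite_atLeastLessThan_int letters]
        by (simp only: cyl_def card_W)
    qed
    also have "\<dots> = real (card (word ` G)) / real (card S) ^ (2 * l)"
      by (simp add: power_one_over divide_simps)
    finally have "1 / 2 \<le> real (card (word ` G)) / real (card S) ^ (2 * l)" .
    moreover have "0 < real (card S) ^ (2 * l)" using S2 by simp
    ultimately have "1 / 2 * real (card S) ^ (2 * l) \<le> real (card (word ` G))"
      by (simp only: pos_le_divide_eq)
    then have "real (card S) ^ (2 * l) \<le> 2 * real (card (word ` G))" by linarith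
    then have "card S ^ (2 * l) \<le> 2 * card (word ` G)"
      by (metis of_nat_le_iff of_nat_mult of_nat_numeral of_nat_power)
    also have "\<dots> \<le> 2 * (k ^ (2 * l + 2 * m) * (2 ^ (2 * l) * card S ^ l))"
      using words card_Z by linarith
    also have "\<dots> = (2 * k ^ (2 * m) * (k ^ (2 * l) * 2 ^ (2 * l))) * card S ^ l"
      by (simp add: power_add)
    also have "card S ^ (2 * l) = card S ^ l * card S ^ l"
      by (simp only: mult_2 power_add)
    finally have "card S ^ l \<le> 2 * k ^ (2 * m) * (k ^ (2 * l) * 2 ^ (2 * l))"
      using S2 by (simp add: mult_le_cancel2)
    also have "k ^ (2 * l) * 2 ^ (2 * l) = (4 * k\<^sup>2) ^ l"
    proof -
      have "4 * k\<^sup>2 = (k * 2)\<^sup>2" by (simp add: power_mult_distrib)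
      then show ?thesis by (simp only: power_mult power_mult_distrib)
    qed
    finally have "card S ^ l \<le> 2 * k ^ (2 * m) * (4 * k\<^sup>2) ^ l" .
    moreover have "2 ^ l * (4 * k\<^sup>2) ^ l \<le> card S ^ l"
    proof -
      have "(2 * (4 * k\<^sup>2)) ^ l \<le> card S ^ l"
        using k(2) by (intro power_mono) auto
      then show ?thesis by (simp only: power_mult_distrib)
    qed
    ultimately have "2 ^ l * (4 * k\<^sup>2) ^ l \<le> 2 * k ^ (2 * m) * (4 * k\<^sup>2) ^ l"
      by linarith
    then show ?thesis using k(1) by (simp add: mult_le_cancel2)
  qed
  have "2 * k ^ (2 * m) < 2 ^ (2 * k ^ (2 * m))" by (rule less_exp)
  with bound[of "2 * k ^ (2 * m)"] k(1) show False by simp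
qed

section \<open>The Borel graph\<close>

lemma standard_Borel_count_space:
  assumes "finite A"
  shows "standard_Borel (count_space A)"
  unfolding standard_Borel_def Polish_topology_def
proof (intro exI conjI)
  show "completely_metrizable_space (discrete_topology A)"
    by (rule completely_metrizable_space_discrete_topology)
  show "separable_space (discrete_topology A)"
    using assms by (simp add: separable_space_discrete_topology countable_finite)
  show "sets (count_space A) = sigma_sets (topspace (discrete_topology A)) {U. openin (discrete_topology A) U}"
    using sets.sigma_sets_eq[of "count_space A"] by (simp add: Pow_def)
qed simp

lemma standard_Borel_singleton:
  assumes "standard_Borel N" "i \<in> space N"
  shows "{i} \<in> sets N"
proof -
  obtain T where T: "completely_metrizable_space T" "topspace T = space N"
    "sets N = sigma_sets (topspace T) {U. openin T U}"
    using assms(1) unfolding standard_Borel_def Polish_topology_def by blast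
  have "t1_space T"
    using T(1) completely_metrizable_imp_metrizable_space metrizable_imp_t1_space by blast
  then have "openin T (topspace T - {i})"
    using assms(2) T(2) by (simp add: t1_space_closedin_singleton closedin_def)
  then have "topspace T - (topspace T - {i}) \<in> sets N"
    unfolding T(3) by (intro sigma_sets.Compl sigma_sets.Basic) simp
  then show ?thesis
    using assms(2) T(2) by (simp add: Diff_Diff_Int)
qed

lemma free_int_action_conjugate:
  assumes "free_int_action X a" "bij_betw f J X"
  shows "free_int_action J (\<lambda>j r. inv_into J f (a j (f r)))"
proof -
  interpret free_int_action X a by fact
  have f: "f r \<in> X" if "r \<in> J" for r using assms(2) that by (auto simp: bij_betw_def)
  have f_inv: "f (inv_into J f x) = x" and inv_J: "inv_into J f x \<in> J" if "x \<in> X" for x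
    using assms(2) that by (auto simp: bij_betw_def f_inv_into_f inv_into_into)
  have inv_f: "inv_into J f (f r) = r" if "r \<in> J" for r
    using assms(2) that by (auto simp: bij_betw_def)
  show ?thesis
  proof
    fix r i j assume r: "r \<in> J"
    show "inv_into J f (a j (f r)) \<in> J" using inv_J closed f r by blast
    show "inv_into J f (a 0 (f r)) = r" using zero f r inv_f by simp
    show "inv_into J f (a (i + j) (f r)) = inv_into J f (a i (f (inv_into J f (a j (f r)))))"
      using f_inv closed f r add by simp
    show "j = 0" if "inv_into J f (a j (f r)) = r"
      using that f_inv[OF closed[OF f[OF r]], of j] free[OF f[OF r]] by simp
  qed
qed

text \<open>
  The vertices have to be real numbers, so the space of aperiodic sequences is transported along an
  arbitrary bijection \<open>f\<close> from a set of reals, which receives the Borel structure that \<open>f\<close> induces.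
\<close>

locale Borel_line_graph =
  fixes S :: "real set" and J :: "real set" and f :: "real \<Rightarrow> int \<Rightarrow> real"
  assumes S: "finite S" "card S \<ge> 2" and f: "bij_betw f J (aperiodic S)"
begin

definition M :: "real measure" where
  "M = vimage_algebra J f (restrict_space borel (aperiodic S))"

definition act :: "int \<Rightarrow> real \<Rightarrow> real" where
  "act j r = inv_into J f (translate j (f r))"

lemma space_M: "space M = J"
  by (simp add: M_def)

lemma f_aperiodic: "r \<in> J \<Longrightarrow> f r \<in> aperiodic S"
  using f by (auto simp: bij_betw_def)

lemma f_act: "r \<in> J \<Longrightarrow> f (act j r) = translate j (f r)"
  using f f_aperiodic translate_aperiodic_iff unfolding act_def
  by (metis bij_betw_def f_inv_into_f)

lemma f_eq_iff: "r \<in> J \<Longrightarrow> s \<in> J \<Longrightarrow> f r = f s \<longleftrightarrow> r = s"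
  using f by (auto simp: bij_betw_def dest: inj_onD)

sublocale free_int_action J act
  unfolding act_def[abs_def] by (rule free_int_action_conjugate[OF free_int_action_translate f])

lemma f_measurable_restrict: "f \<in> M \<rightarrow>\<^sub>M restrict_space borel (aperiodic S)"
  unfolding M_def using f_aperiodic
  by (intro measurable_vimage_algebra1) (simp add: space_restrict_space)

lemma f_measurable: "f \<in> borel_measurable M"
  using f_measurable_restrict by (simp add: measurable_restrict_space2_iff)

lemma Borel_graph: "Borel_graph M (line_graph J act)"
  unfolding Borel_graph_def
proof (intro conjI)
  show "standard_Borel M"
    unfolding M_def using f
    by (intro standard_Borel_vimage standard_Borel_gdelta gdelta_aperiodic S)
      (simp add: space_restrict_space)
  have [measurable]: "(\<lambda>p. f (fst p) i) \<in> borel_measurable (M \<Otimes>\<^sub>M M)"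
    "(\<lambda>p. f (snd p) i) \<in> borel_measurable (M \<Otimes>\<^sub>M M)" for i
    by (intro measurable_compose[OF _ borel_measurable_fun_component]
        measurable_compose[OF measurable_fst f_measurable]
        measurable_compose[OF measurable_snd f_measurable])+
  have [measurable]: "Measurable.pred (M \<Otimes>\<^sub>M M) (\<lambda>p. f (snd p) i = f (fst p) j)"
    "Measurable.pred (M \<Otimes>\<^sub>M M) (\<lambda>p. f (fst p) i = f (snd p) j)" for i j
    unfolding pred_def by (intro borel_measurable_eq; measurable)+
  have step: "s = act 1 r \<longleftrightarrow> (\<forall>i. f s i = f r (i + 1))" if "r \<in> J" "s \<in> J" for r s
    using f_eq_iff[OF that(2) closed[OF that(1)], of 1] f_act[OF that(1), of 1]
    by (auto simp: fun_eq_iff translate_def)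
  have "line_graph J act = {p \<in> space (M \<Otimes>\<^sub>M M).
      (\<forall>i. f (snd p) i = f (fst p) (i + 1)) \<or> (\<forall>i. f (fst p) i = f (snd p) (i + 1))}"
  proof (rule set_eqI)
    show "p \<in> line_graph J act \<longleftrightarrow> p \<in> {p \<in> space (M \<Otimes>\<^sub>M M).
      (\<forall>i. f (snd p) i = f (fst p) (i + 1)) \<or> (\<forall>i. f (fst p) i = f (snd p) (i + 1))}" for p
      by (cases p) (simp add: line_graph_def space_pair_measure space_M step cong: conj_cong)
  qed
  also have "\<dots> \<in> sets (M \<Otimes>\<^sub>M M)"
    by measurable
  finally show "line_graph J act \<in> sets (M \<Otimes>\<^sub>M M)" .
qed (simp_all add: sym_line_graph irrefl_line_graph)

text \<open>
  Coloring a sequence by its letters at 0 and 1 is distinguishing: an automorphism that preserves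
  these colors and the direction of an orbit fixes it pointwise, and one that reverses an orbit would
  force period 2 on it.
\<close>

lemma pair_coloring:
  "Borel_distinguishing_coloring M (line_graph J act) (count_space (S \<times> S)) (\<lambda>r. (f r 0, f r 1))"
  unfolding Borel_distinguishing_coloring_def distinguishing_coloring_def
proof (intro conjI allI impI)
  have f_S: "f r i \<in> S" if "r \<in> J" for r i
    using f_aperiodic[OF that] by (auto simp: aperiodic_def)
  show "standard_Borel (count_space (S \<times> S))"
    using S by (intro standard_Borel_count_space) simp
  show "(\<lambda>r. (f r 0, f r 1)) \<in> space M \<rightarrow> space (count_space (S \<times> S))"
    using f_S by (simp add: space_M)
  show "(\<lambda>r. (f r 0, f r 1)) \<in> M \<rightarrow>\<^sub>M count_space (S \<times> S)"
  proof (rule measurable_count_space_eq2[THEN iffD2])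
    have [measurable]: "(\<lambda>r. f r i) \<in> borel_measurable M" for i
      by (rule measurable_compose[OF f_measurable borel_measurable_fun_component])
    have "(\<lambda>r. (f r 0, f r 1)) -` {p} \<inter> space M = {r \<in> space M. f r 0 = fst p \<and> f r 1 = snd p}" for p
      by auto
    also have "\<dots> p \<in> sets M" for p by measurable
    finally show "(\<lambda>r. (f r 0, f r 1)) \<in> space M \<rightarrow> S \<times> S \<and>
        (\<forall>p\<in>S \<times> S. (\<lambda>r. (f r 0, f r 1)) -` {p} \<inter> space M \<in> sets M)"
      using f_S by (simp add: space_M)
  qed (use S in simp)
next
  fix \<phi> assume \<phi>: "graph_automorphism (space M) (line_graph J act) \<phi> \<and> (\<exists>r\<in>space M. \<phi> r \<noteq> r)"
  then have auto: "graph_automorphism J (line_graph J act) \<phi>" by (simp add: space_M)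
  show "\<exists>r\<in>space M. (f r 0, f r 1) \<noteq> (f (\<phi> r) 0, f (\<phi> r) 1)"
  proof (rule ccontr)
    assume "\<not> ?thesis"
    then have same: "f r 0 = f (\<phi> r) 0" "f r 1 = f (\<phi> r) 1" if "r \<in> J" for r
      using that by (auto simp: space_M)
    have "\<phi> r = r" if r: "r \<in> J" for r
    proof -
      have \<phi>r: "\<phi> r \<in> J" using auto r by (auto simp: graph_automorphism_def bij_betw_def)
      obtain s where s: "s \<in> {1, - 1}" and orbit: "\<And>j. \<phi> (act j r) = act (s * j) (\<phi> r)"
        using automorphism_on_orbit[OF auto r] by blast
      have letters: "f r j = f (\<phi> r) (s * j)" "f r (j + 1) = f (\<phi> r) (s * j + 1)" for j
        using same[OF closed[OF r], of j] f_act[OF r, of j] f_act[OF \<phi>r, of "s * j"] orbit[of j]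
        by (simp_all add: translate_def add.commute)
      \<comment> \<open>If the orbit were reversed, the two coordinates of the color would compare it with two
        reflections of its image about different centers; these differ by a translation by 2.\<close>
      have "s = 1"
      proof (rule ccontr)
        assume "s \<noteq> 1"
        then have [simp]: "s = - 1" using s by simp
        have "f r (i + 2) = f r i" for i
          using letters(2)[of "i + 1"] letters(1)[of i] by (simp add: algebra_simps)
        then have "translate 2 (f r) = f r" by (simp add: translate_def)
        then show False using f_aperiodic[OF r] by (auto simp: aperiodic_def)
      qed
      then have "f r = f (\<phi> r)" using letters(1) by auto
      then show ?thesis using f_eq_iff[OF r \<phi>r] by simp
    qed
    then show False using \<phi> by (auto simp: space_M)
  qed
qed

lemma few_colors_not_distinguishing:
  fixes N :: "'c measure"
  assumes N: "finite (space N)" "8 * (card (space N))\<^sup>2 \<le> card S" and "J \<noteq> {}"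
  shows "\<not> Borel_distinguishing_coloring M (line_graph J act) N c"
proof
  assume c: "Borel_distinguishing_coloring M (line_graph J act) N c"
  define g where "g = inv_into J f"
  have g: "g x \<in> J" "f (g x) = x" if "x \<in> aperiodic S" for x
    using f that unfolding g_def by (auto simp: bij_betw_def f_inv_into_f inv_into_into)
  have c_N: "c r \<in> space N" if "r \<in> J" for r
    using c that unfolding Borel_distinguishing_coloring_def
    by (auto simp: space_M dest: measurable_space)
  have "{x \<in> aperiodic S. c (g x) = i} \<in> sets borel" for i
  proof (cases "i \<in> space N")
    case True
    then have "{i} \<in> sets N"
      using c standard_Borel_singleton by (auto simp: Borel_distinguishing_coloring_def)
    then have "c -` {i} \<inter> space M \<in> sets M"
      using c by (auto simp: Borel_distinguishing_coloring_def intro: measurable_sets)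
    then obtain A where A: "A \<in> sets (restrict_space borel (aperiodic S))"
      "c -` {i} \<inter> J = f -` A \<inter> J"
      using f_aperiodic unfolding M_def space_M[unfolded M_def]
      by (subst (asm) sets_vimage_algebra2) (auto simp: space_restrict_space)
    have "A \<subseteq> aperiodic S"
      using sets.sets_into_space[OF A(1)] by (simp add: space_restrict_space)
    then have "{x \<in> aperiodic S. c (g x) = i} = A"
    proof (intro set_eqI)
      fix x
      have "x \<in> aperiodic S \<Longrightarrow> c (g x) = i \<longleftrightarrow> x \<in> A"
        using eqset_imp_iff[OF A(2), of "g x"] g[of x] by simp
      with \<open>A \<subseteq> aperiodic S\<close> show "x \<in> {x \<in> aperiodic S. c (g x) = i} \<longleftrightarrow> x \<in> A" by blast
    qed
    then show ?thesis
      using A(1) aperiodic_borel[OF S(1)] by (simp add: sets_restrict_space_iff)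
  next
    case False
    then have "{x \<in> aperiodic S. c (g x) = i} = {}" using c_N g by auto
    then show ?thesis by (simp only: sets.empty_sets)
  qed
  moreover have "card (space N) > 0"
    using \<open>J \<noteq> {}\<close> c_N N(1) by (auto simp: card_gt_0_iff)
  ultimately obtain x y where xy: "x \<in> aperiodic S" "y \<in> aperiodic S" "x \<noteq> y"
    "\<And>j. c (g (translate j x)) = c (g (translate j y))"
    using Borel_coloring_same_itinerary[of S "space N" "c \<circ> g"] S(1) N c_N g by auto
  have "act j (g z) = g (translate j z)" if "z \<in> aperiodic S" for j z
    using g[OF that] by (simp add: act_def g_def)
  then have "\<not> distinguishing_coloring J (line_graph J act) (space N) c"
    using xy g by (intro same_itinerary_not_distinguishing[of "g x" "g y"]) metis+
  then show False
    using c by (simp add: Borel_distinguishing_coloring_def space_M)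
qed

end

lemma aperiodic_nonempty:
  assumes "finite S" "card S \<ge> 2"
  shows "aperiodic S \<noteq> {}"
proof -
  have "\<not> card S \<le> Suc 0" using assms(2) by simp
  then obtain a b where ab: "a \<in> S" "b \<in> S" "a \<noteq> b"
    using card_le_Suc0_iff_eq[OF assms(1)] by blast
  have "translate p (\<lambda>i. if i = 0 then a else b) \<noteq> (\<lambda>i. if i = 0 then a else b)" if "p \<noteq> 0" for p
    using that ab(3) by (auto simp: translate_def fun_eq_iff intro!: exI[of _ 0])
  then have "(\<lambda>i. if i = 0 then a else b) \<in> aperiodic S"
    using ab by (auto simp: aperiodic_def)
  then show ?thesis by blast
qed

lemma card_of_ordLess_iff_card_less:
  assumes "finite A" "finite B"
  shows "|A| <o |B| \<longleftrightarrow> card A < card B"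
proof -
  have "|B| \<le>o |A| \<longleftrightarrow> card B \<le> card A"
    using inj_on_iff_card_le[OF assms(2,1)] by (simp add: card_of_ordLeq)
  moreover have "|A| <o |B| \<longleftrightarrow> \<not> |B| \<le>o |A|"
    by (simp only: not_ordLeq_iff_ordLess[OF card_of_Well_order card_of_Well_order])
  ultimately show ?thesis by (simp add: not_le)
qed

theorem theorem8:
  fixes n :: nat
  assumes "n \<ge> 3"
  shows "\<exists>(M :: real measure) E. Borel_graph M E \<and>
           |{..<2::nat}| =o distinguishing_number (space M) E \<and>
           distinguishing_number (space M) E <o |{..<n}| \<and>
           |{..<n}| \<le>o Borel_distinguishing_number M E \<and>
           Borel_distinguishing_number M E <o natLeq"
proof -
  define S where "S = real ` {..<8 * n\<^sup>2}"
  have fin_S: "finite S" and card_S: "card S = 8 * n\<^sup>2" by (auto simp: S_def card_image)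
  have "n\<^sup>2 \<ge> 1" using assms by (simp add: Suc_le_eq)
  then have S2: "card S \<ge> 2" using card_S by linarith
  then have "aperiodic S \<noteq> {}"
    using aperiodic_nonempty fin_S by blast
  obtain g :: "(int \<Rightarrow> real) \<Rightarrow> real" where g: "inj_on g (aperiodic S)"
  proof -
    obtain T where "Polish_topology T" "topspace T = aperiodic S"
      using standard_Borel_gdelta[OF gdelta_aperiodic[OF fin_S]]
      by (auto simp: standard_Borel_def space_restrict_space)
    then show ?thesis
      using Polish_lepoll_reals[of T] that by (auto simp: lepoll_def)
  qed
  define J where "J = g ` aperiodic S"
  interpret Borel_line_graph S J "inv_into (aperiodic S) g"
    using fin_S S2 g by unfold_locales (auto simp: J_def inj_on_imp_bij_betw bij_betw_inv_into)
  let ?E = "line_graph J act"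
  have "J \<noteq> {}" using \<open>aperiodic S \<noteq> {}\<close> by (simp add: J_def)

  have D: "distinguishing_number J ?E =o |{..<2::nat}|"
  proof -
    obtain h :: "real \<Rightarrow> nat set" where "inj h"
      using nat_sets_eqpoll_reals eqpoll_sym eqpoll_imp_lepoll unfolding lepoll_def by (metis top_greatest Pow_UNIV)
    then obtain c where "distinguishing_coloring J ?E {..<2::nat} c"
      using distinguishing_2_coloring inj_on_subset by blast
    then have "distinguishing_number J ?E \<le>o |{..<2::nat}|"
      by (rule distinguishing_number_le)
    moreover have "|{..<2::nat}| \<le>o distinguishing_number J ?E"
    proof -
      obtain I c where c: "distinguishing_coloring J ?E I c" and I: "distinguishing_number J ?E = |I|"
        by (rule distinguishing_number_attained)
      obtain x where x: "x \<in> J" using \<open>J \<noteq> {}\<close> by blast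
      then obtain y where y: "y \<in> J" "c y \<noteq> c x"
        using one_color_not_distinguishing[OF x, of c I] c by blast
      have "(\<lambda>i::nat. if i = 0 then c x else c y) ` {..<2} \<subseteq> I"
        using c x y by (auto simp: distinguishing_coloring_def)
      moreover have "inj_on (\<lambda>i::nat. if i = 0 then c x else c y) {..<2}"
        using y by (auto simp: inj_on_def less_2_cases_iff)
      ultimately show ?thesis
        unfolding I using card_of_ordLeq by blast
    qed
    ultimately show ?thesis by (simp add: ordIso_iff_ordLeq)
  qed
  have "|{..<2::nat}| <o |{..<n}|"
    using assms by (simp add: card_of_ordLess_iff_card_less)
  then have "distinguishing_number J ?E <o |{..<n}|"
    using D ordIso_ordLess_trans by blast
  moreover have "|{..<n}| \<le>o Borel_distinguishing_number M ?E"
  proof -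
    obtain N :: "real measure" and c where c: "Borel_distinguishing_coloring M ?E N c"
      and N: "Borel_distinguishing_number M ?E = |space N|"
      by (rule Borel_distinguishing_number_attained[OF Borel_graph])
    have "\<not> |space N| <o |{..<n}|"
    proof
      assume less: "|space N| <o |{..<n}|"
      then have fin: "finite (space N)"
        using card_of_ordLeq_infinite ordLess_imp_ordLeq by blast
      then have "card (space N) < n"
        using less fin by (simp add: card_of_ordLess_iff_card_less)
      then have "8 * (card (space N))\<^sup>2 \<le> card S"
        using card_S by (simp add: power_mono)
      then show False
        using few_colors_not_distinguishing[OF fin _ \<open>J \<noteq> {}\<close>] c by blast
    qed
    then show ?thesis
      unfolding N by (simp only: not_ordLess_iff_ordLeq[OF card_of_Well_order card_of_Well_order])
  qed
  moreover have "Borel_distinguishing_number M ?E <o natLeq"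
  proof -
    have "Borel_distinguishing_number M ?E \<le>o |S \<times> S|"
      using Borel_distinguishing_number_le[OF pair_coloring] by simp
    moreover have "|S \<times> S| <o natLeq"
      using fin_S finite_iff_ordLess_natLeq by blast
    ultimately show ?thesis by (rule ordLeq_ordLess_trans)
  qed
  ultimately show ?thesis
    using Borel_graph ordIso_symmetric[OF D] space_M by metis
qed

end
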